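(* Let $\alpha_0,\dots,\alpha_5$ be complex parameters with $2\alpha_0+2\alpha_1+2\alpha_2+2\alpha_3+\alpha_4+\alpha_5=1$, and consider the Hamiltonian system $$\frac{dx}{dt}=\frac{\partial H}{\partial y},\ \frac{dy}{dt}=-\frac{\partial H}{\partial x},\ \frac{dz}{dt}=\frac{\partial H}{\partial w},\ \frac{dw}{dt}=-\frac{\partial H}{\partial z},\ \frac{dq}{dt}=\frac{\partial H}{\partial p},\ \frac{dp}{dt}=-\frac{\partial H}{\partial q}$$ with $$\begin{aligned} tH={}&x^2y^2+2\alpha_0xy+x+ty+z^2w^2+2(\alpha_0+\alpha_1+\alpha_2)zw+tw\\&+q^2p^2-tq^2p+(\alpha_4+\alpha_5-1)qp-\alpha_4tq+2yz(zw+\alpha_2)-2(y+w)p.\end{aligned}$$ This system admits extended affine Weyl group symmetry of type $B_5^{(1)}$ as a group of Bäcklund transformations, with generators given, in the notation $( * ):=(x,y,z,w,q,p,t;\alpha_0,\dots,\alpha_5)$, by $$\begin{aligned} s_0:( * )&\to\left(-x-\tfrac{2\alpha_0}{y}-\tfrac{1}{y^2},-y,-z,-w,-q,-p,-t;-\alpha_0,\alpha_1+2\alpha_0,\alpha_2,\alpha_3,\alpha_4,\alpha_5\right),\\ s_1:( * )&\to\left(x,y-\tfrac{\alpha_1}{x-z},z,w+\tfrac{\alpha_1}{x-z},q,p,t;\alpha_0+\alpha_1,-\alpha_1,\alpha_2+\alpha_1,\alpha_3,\alpha_4,\alpha_5\right),\\ s_2:( * )&\to\left(x,y,z+\tfrac{\alpha_2}{w},w,q,p,t;\alpha_0,\alpha_1+\alpha_2,-\alpha_2,\alpha_3+\alpha_2,\alpha_4,\alpha_5\right),\\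 s_3:( * )&\to\left(x,y,z,w-\tfrac{\alpha_3q}{zq-1},q,p-\tfrac{\alpha_3z}{zq-1},t;\alpha_0,\alpha_1,\alpha_2+\alpha_3,-\alpha_3,\alpha_4+\alpha_3,\alpha_5+\alpha_3\right),\\ s_4:( * )&\to\left(x,y,z,w,q+\tfrac{\alpha_4}{p},p,t;\alpha_0,\alpha_1,\alpha_2,\alpha_3+\alpha_4,-\alpha_4,\alpha_5\right),\\ s_5:( * )&\to\left(x,y,z,w,q+\tfrac{\alpha_5}{p-t},p,t;\alpha_0,\alpha_1,\alpha_2,\alpha_3+\alpha_5,\alpha_4,-\alpha_5\right),\\ \pi:( * )&\to(x,y,z,w,q,p-t,-t;\alpha_0,\alpha_1,\alpha_2,\alpha_3,\alpha_5,\alpha_4). \end{aligned}$$ That is: each of $s_0,\dots,s_5,\pi$ is a Bäcklund transformation of the system; $s_0,\dots,s_5$ satisfy the defining relations of the affine Weyl group of type $B_5^{(1)}$; and $\pi$ acts on them as an automorphism of the Dynkin diagram.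
   Context: The unknowns are complex functions $x,y,z,w,q,p$ of $t$. A Bäcklund transformation of the system is a birational transformation $s$ of $(x,y,z,w,q,p,t)$ (rational in the parameters; here $s(t)=\pm t$), together with an affine transformation of the parameters, that maps the system to itself: whenever $(x,\dots,p)$ solves the system with parameters $\alpha_i$, the functions $s(x),\dots,s(p)$, as functions of $s(t)$, solve the same system with $\alpha_i$ replaced by $s(\alpha_i)$. Transformations act as automorphisms of the field of rational functions in $x,y,z,w,q,p,t,\alpha_i$ and products are compositions. Dynkin diagram of type $B_5^{(1)}$: nodes $0,\dots,5$, with a double edge between $0$ and $1$ and simple edges $1-2,\ 2-3,\ 3-4,\ 3-5$. Defining relations of the affine Weyl group: $s_i^2=1$; $(s_0s_1)^4=1$; $(s_is_j)^3=1$ if $i,j$ are joined by a simple edge; $(s_is_j)^2=1$ for $i\neq j$ not joined. The transformation $\pi$ acts by $\pi s_i\pi^{-1}=s_{\sigma(i)}$ with $\sigma=(4\,5)$. *)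

theory Defs
  imports
    "HOL-Analysis.Analysis"
    "HOL-Library.Poly_Mapping"
    "HOL-Computational_Algebra.Fraction_Field"
begin

section \<open>The field of rational functions in \<open>x, y, z, w, q, p, t\<close> and the parameters\<close>

text \<open>
  The parameters \<open>\<alpha>\<^sub>0, \<dots>, \<alpha>\<^sub>5\<close> are subject to
  \<open>2\<alpha>\<^sub>0 + 2\<alpha>\<^sub>1 + 2\<alpha>\<^sub>2 + 2\<alpha>\<^sub>3 + \<alpha>\<^sub>4 + \<alpha>\<^sub>5 = 1\<close>, so the field is purely transcendental over the
  complex numbers in \<open>x, y, z, w, q, p, t, \<alpha>\<^sub>0, \<dots>, \<alpha>\<^sub>4\<close>; the parameter \<open>\<alpha>\<^sub>5\<close> is the
  element of it that the relation dictates.  The order on the indeterminates has no mathematical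
  meaning: \<open>Poly_Mapping\<close> needs one to make the polynomial ring an integral domain.
\<close>

datatype var = VX | VY | VZ | VW | VQ | VP | VT | VA0 | VA1 | VA2 | VA3 | VA4

primrec var_index :: "var \<Rightarrow> nat" where
  "var_index VX = 0" | "var_index VY = 1" | "var_index VZ = 2" | "var_index VW = 3"
| "var_index VQ = 4" | "var_index VP = 5" | "var_index VT = 6" | "var_index VA0 = 7"
| "var_index VA1 = 8" | "var_index VA2 = 9" | "var_index VA3 = 10" | "var_index VA4 = 11"

lemma var_index_eq_iff: "var_index u = var_index v \<longleftrightarrow> u = v"
  by (cases u; cases v; simp)

instantiation var :: linorder
begin
definition less_eq_var :: "var \<Rightarrow> var \<Rightarrow> bool" where
  "less_eq_var u v \<longleftrightarrow> var_index u \<le> var_index v"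
definition less_var :: "var \<Rightarrow> var \<Rightarrow> bool" where
  "less_var u v \<longleftrightarrow> var_index u < var_index v"
instance
  by standard (auto simp: less_eq_var_def less_var_def var_index_eq_iff)
end

type_synonym mpoly = "(var \<Rightarrow>\<^sub>0 nat) \<Rightarrow>\<^sub>0 complex"

type_synonym ratfun = "mpoly fract"

definition const :: "complex \<Rightarrow> ratfun" where
  "const c = Fract (Poly_Mapping.single 0 c) 1"

definition indet :: "var \<Rightarrow> ratfun" where
  "indet v = Fract (Poly_Mapping.single (Poly_Mapping.single v 1) 1) 1"

abbreviation "X \<equiv> indet VX"
abbreviation "Y \<equiv> indet VY"
abbreviation "Z \<equiv> indet VZ"
abbreviation "W \<equiv> indet VW"
abbreviation "Q \<equiv> indet VQ"
abbreviation "P \<equiv> indet VP"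
abbreviation "T \<equiv> indet VT"
abbreviation "A0 \<equiv> indet VA0"
abbreviation "A1 \<equiv> indet VA1"
abbreviation "A2 \<equiv> indet VA2"
abbreviation "A3 \<equiv> indet VA3"
abbreviation "A4 \<equiv> indet VA4"

definition A5 :: ratfun where
  "A5 = 1 - 2 * A0 - 2 * A1 - 2 * A2 - 2 * A3 - A4"

definition A :: "nat \<Rightarrow> ratfun" where
  "A i = [A0, A1, A2, A3, A4, A5] ! i"

definition generators :: "ratfun list" where
  "generators = [X, Y, Z, W, Q, P, T, A0, A1, A2, A3, A4, A5]"

definition poly_value :: "mpoly \<Rightarrow> (var \<Rightarrow> complex) \<Rightarrow> complex" where
  "poly_value g a =
     (\<Sum>m\<in>Poly_Mapping.keys g. Poly_Mapping.lookup g m *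
        (\<Prod>v\<in>Poly_Mapping.keys m. a v ^ Poly_Mapping.lookup m v))"

definition regular_at :: "ratfun \<Rightarrow> (var \<Rightarrow> complex) \<Rightarrow> bool" where
  "regular_at f a \<longleftrightarrow> (\<exists>n d. f = Fract n d \<and> poly_value d a \<noteq> 0)"

text \<open>Unspecified where \<open>f\<close> is not regular.\<close>

definition value_at :: "ratfun \<Rightarrow> (var \<Rightarrow> complex) \<Rightarrow> complex" where
  "value_at f a =
     (THE c. \<exists>n d. f = Fract n d \<and> poly_value d a \<noteq> 0 \<and> c = poly_value n a / poly_value d a)"

text \<open>A birational transformation is an automorphism of the field over the complex numbers.\<close>

definition field_automorphism :: "(ratfun \<Rightarrow> ratfun) \<Rightarrow> bool" where
  "field_automorphism \<phi> \<longleftrightarrow>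
     bij \<phi> \<and> (\<forall>f g. \<phi> (f + g) = \<phi> f + \<phi> g) \<and> (\<forall>f g. \<phi> (f * g) = \<phi> f * \<phi> g) \<and>
     (\<forall>c. \<phi> (const c) = const c)"

section \<open>The Hamiltonian system\<close>

definition hamiltonian ::
  "(nat \<Rightarrow> complex) \<Rightarrow> complex \<Rightarrow> complex \<Rightarrow> complex \<Rightarrow> complex \<Rightarrow> complex \<Rightarrow> complex \<Rightarrow> complex \<Rightarrow> complex"
where
  "hamiltonian \<alpha> x y z w q p t =
     (x^2 * y^2 + 2 * \<alpha> 0 * x * y + x + t * y
      + z^2 * w^2 + 2 * (\<alpha> 0 + \<alpha> 1 + \<alpha> 2) * z * w + t * w
      + q^2 * p^2 - t * q^2 * p + (\<alpha> 4 + \<alpha> 5 - 1) * q * p - \<alpha> 4 * t * q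
      + 2 * y * z * (z * w + \<alpha> 2) - 2 * (y + w) * p) / t"

definition admissible_parameters :: "(nat \<Rightarrow> complex) \<Rightarrow> bool" where
  "admissible_parameters \<alpha> \<longleftrightarrow> 2 * \<alpha> 0 + 2 * \<alpha> 1 + 2 * \<alpha> 2 + 2 * \<alpha> 3 + \<alpha> 4 + \<alpha> 5 = 1"

text \<open>
  Solutions are considered on open sets of times, and \<open>t = 0\<close> is excluded because the
  Hamiltonian has a pole there.
\<close>

definition solves ::
  "(nat \<Rightarrow> complex) \<Rightarrow> complex set \<Rightarrow> (complex \<Rightarrow> complex) \<Rightarrow> (complex \<Rightarrow> complex) \<Rightarrow>
   (complex \<Rightarrow> complex) \<Rightarrow> (complex \<Rightarrow> complex) \<Rightarrow> (complex \<Rightarrow> complex) \<Rightarrow> (complex \<Rightarrow> complex) \<Rightarrow> bool"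
where
  "solves \<alpha> U x y z w q p \<longleftrightarrow>
     admissible_parameters \<alpha> \<and> open U \<and> 0 \<notin> U \<and>
     (\<forall>t\<in>U.
       (x has_field_derivative
          deriv (\<lambda>\<eta>. hamiltonian \<alpha> (x t) \<eta> (z t) (w t) (q t) (p t) t) (y t)) (at t) \<and>
       (y has_field_derivative
          - deriv (\<lambda>\<xi>. hamiltonian \<alpha> \<xi> (y t) (z t) (w t) (q t) (p t) t) (x t)) (at t) \<and>
       (z has_field_derivative
          deriv (\<lambda>\<eta>. hamiltonian \<alpha> (x t) (y t) (z t) \<eta> (q t) (p t) t) (w t)) (at t) \<and>
       (w has_field_derivative
          - deriv (\<lambda>\<xi>. hamiltonian \<alpha> (x t) (y t) \<xi> (w t) (q t) (p t) t) (z t)) (at t) \<and>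
       (q has_field_derivative
          deriv (\<lambda>\<eta>. hamiltonian \<alpha> (x t) (y t) (z t) (w t) (q t) \<eta> t) (p t)) (at t) \<and>
       (p has_field_derivative
          - deriv (\<lambda>\<xi>. hamiltonian \<alpha> (x t) (y t) (z t) (w t) \<xi> (p t) t) (q t)) (at t))"

section \<open>Baecklund transformations\<close>

fun point ::
  "(nat \<Rightarrow> complex) \<Rightarrow> complex \<Rightarrow> complex \<Rightarrow> complex \<Rightarrow> complex \<Rightarrow> complex \<Rightarrow> complex \<Rightarrow> complex \<Rightarrow>
   var \<Rightarrow> complex"
where
  "point \<alpha> x y z w q p t VX = x"
| "point \<alpha> x y z w q p t VY = y"
| "point \<alpha> x y z w q p t VZ = z"
| "point \<alpha> x y z w q p t VW = w"
| "point \<alpha> x y z w q p t VQ = q"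
| "point \<alpha> x y z w q p t VP = p"
| "point \<alpha> x y z w q p t VT = t"
| "point \<alpha> x y z w q p t VA0 = \<alpha> 0"
| "point \<alpha> x y z w q p t VA1 = \<alpha> 1"
| "point \<alpha> x y z w q p t VA2 = \<alpha> 2"
| "point \<alpha> x y z w q p t VA3 = \<alpha> 3"
| "point \<alpha> x y z w q p t VA4 = \<alpha> 4"

text \<open>
  The transformation is applied to those solutions along which the rational functions
  \<open>\<phi> X, \<dots>, \<phi> P\<close> are regular.  As \<open>\<epsilon>\<close> is \<open>1\<close> or \<open>-1\<close>, the new time \<open>\<tau> = \<epsilon> * t\<close>
  corresponds to the old time \<open>t = \<epsilon> * \<tau>\<close>.  The numbers \<open>b i\<close> and \<open>c i j\<close> are the coefficients of
  the affine transformation of the parameters; they are not unique, because of the relation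
  between the parameters, but the values \<open>b i + (\<Sum>j\<le>5. c i j * \<alpha> j)\<close> are.
\<close>

definition baecklund :: "(ratfun \<Rightarrow> ratfun) \<Rightarrow> bool" where
  "baecklund \<phi> \<longleftrightarrow> field_automorphism \<phi> \<and>
     (\<exists>\<epsilon>\<in>{1, -1}. \<exists>b c.
        \<phi> T = const \<epsilon> * T \<and>
        (\<forall>i\<le>5. \<phi> (A i) = const (b i) + (\<Sum>j\<le>5. const (c i j) * A j)) \<and>
        (\<forall>\<alpha> U x y z w q p.
           let pt = (\<lambda>t. point \<alpha> (x t) (y t) (z t) (w t) (q t) (p t) t);
               new = (\<lambda>f \<tau>. value_at (\<phi> f) (pt (\<epsilon> * \<tau>)))
           in solves \<alpha> U x y z w q p \<and> (\<forall>t\<in>U. \<forall>f\<in>{X, Y, Z, W, Q, P}. regular_at (\<phi> f) (pt t))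
              \<longrightarrow> solves (\<lambda>i. b i + (\<Sum>j\<le>5. c i j * \<alpha> j)) ((*) \<epsilon> ` U)
                    (new X) (new Y) (new Z) (new W) (new Q) (new P)))"

section \<open>The Dynkin diagram of type \<open>B\<^sub>5\<^sup>(\<^sup>1\<^sup>)\<close>\<close>

definition cox :: "nat \<Rightarrow> nat \<Rightarrow> nat" where
  "cox i j =
     (if i = j then 1
      else if {i, j} = {0, 1} then 4
      else if {i, j} \<in> {{1, 2}, {2, 3}, {3, 4}, {3, 5}} then 3
      else 2)"

text \<open>For \<open>i = j\<close> this includes the relations \<open>s i \<circ> s i = id\<close>, as \<open>cox i i = 1\<close>.\<close>

definition weyl_relations_B5 :: "(nat \<Rightarrow> 'a \<Rightarrow> 'a) \<Rightarrow> bool" where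
  "weyl_relations_B5 s \<longleftrightarrow> (\<forall>i\<le>5. \<forall>j\<le>5. (s i \<circ> s j) ^^ cox i j = id)"

definition diagram_automorphism :: "(nat \<Rightarrow> nat) \<Rightarrow> bool" where
  "diagram_automorphism \<sigma> \<longleftrightarrow>
     bij_betw \<sigma> {..5} {..5} \<and> (\<forall>i\<le>5. \<forall>j\<le>5. cox (\<sigma> i) (\<sigma> j) = cox i j)"

end

theory Submission
  imports Defs
begin

text \<open>
  The theorem has three parts: the seven assignments of images extend to automorphisms of the
  field of rational functions, these automorphisms satisfy the Coxeter relations, and they carry
  solutions to solutions.

  \<^bold>\<open>Automorphisms.\<close> A substitution of rational functions for the indeterminates extends
  from polynomials to the field as soon as it kills no nonzero polynomial. Each of the seven
  substitutions is formally an involution, up to powers of one denominator \<open>h\<close>, and a polynomial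
  with image \<open>0\<close> would, on substituting once more, be \<open>0\<close> itself. So injectivity and bijectivity
  both come from the images of the twelve indeterminates (\<open>ratfun_involution_extend\<close>).

  \<^bold>\<open>Relations.\<close> An endomorphism that fixes the constants is determined by the images of the
  indeterminates (\<open>ratfun_hom_eqI\<close>), and for involutions the relation \<open>(a \<circ> b) ^^ m = id\<close> is the
  braid relation of length \<open>m\<close>. What remains are identities between explicit fractions, in which
  every denominator is the image of one of \<open>Y\<close>, \<open>X - Z\<close>, \<open>W\<close>, \<open>Z * Q - 1\<close>, \<open>P\<close>, \<open>P - T\<close> under an
  automorphism, hence nonzero.

  \<^bold>\<open>Solutions.\<close> For each generator the chain rule and the explicit vector field reduce the
  claim to a rational identity that holds after clearing denominators. This needs the
  denominators not to vanish along the solution, while the hypothesis only says that the images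
  are regular there as elements of the field. The two agree even where the parameter \<open>\<alpha>\<^sub>i\<close> of the
  generator is \<open>0\<close> and the formula degenerates: regularity persists when \<open>\<alpha>\<^sub>i\<close> is moved a little,
  and for the moved parameter the pole is visible (\<open>denominator_nonzero\<close>).
\<close>

section \<open>Evaluation of polynomials\<close>

definition mvar :: "var \<Rightarrow> mpoly" where
  "mvar v = Poly_Mapping.single (Poly_Mapping.single v 1) 1"

definition mconst :: "complex \<Rightarrow> mpoly" where
  "mconst a = Poly_Mapping.single 0 a"

lemma finite_UNIV_var: "finite (UNIV :: var set)"
proof (rule finite_subset)
  show "(UNIV :: var set) \<subseteq> {VX, VY, VZ, VW, VQ, VP, VT, VA0, VA1, VA2, VA3, VA4}"
    using var.exhaust by blast
qed simp

lemma poly_mapping_eq_sum_single: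
  "g = (\<Sum>m\<in>Poly_Mapping.keys g. Poly_Mapping.single m (Poly_Mapping.lookup g m))"
proof (rule poly_mapping_eqI)
  fix k
  have "(\<Sum>m\<in>Poly_Mapping.keys g.
           Poly_Mapping.lookup (Poly_Mapping.single m (Poly_Mapping.lookup g m)) k) =
        (\<Sum>m\<in>Poly_Mapping.keys g. if m = k then Poly_Mapping.lookup g k else 0)"
    by (rule sum.cong) (auto simp: lookup_single)
  also have "\<dots> = Poly_Mapping.lookup g k"
    by (auto simp: not_in_keys_iff_lookup_eq_zero)
  finally show "Poly_Mapping.lookup g k = Poly_Mapping.lookup
      (\<Sum>m\<in>Poly_Mapping.keys g. Poly_Mapping.single m (Poly_Mapping.lookup g m)) k"
    by (simp add: lookup_sum)
qed

lemma poly_mapping_induct_single [case_names zero single add]: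
  fixes g :: "'k \<Rightarrow>\<^sub>0 'b::comm_monoid_add"
  assumes "R 0" and "\<And>m a. R (Poly_Mapping.single m a)" and "\<And>f g. R f \<Longrightarrow> R g \<Longrightarrow> R (f + g)"
  shows "R g"
proof -
  have "R (\<Sum>m\<in>S. Poly_Mapping.single m (Poly_Mapping.lookup g m))" if "finite S" for S
    using that by (induction S rule: finite_induct) (simp_all add: assms)
  then show ?thesis
    by (metis poly_mapping_eq_sum_single finite_keys)
qed

text \<open>
  Every monomial is a product of powers of indeterminates, so it suffices to treat sums and
  products.
\<close>

lemma mpoly_induct [case_names const var add mult]:
  assumes const: "\<And>a. R (mconst a)" and var: "\<And>v. R (mvar v)"
    and add: "\<And>f g. R f \<Longrightarrow> R g \<Longrightarrow> R (f + g)" and mult: "\<And>f g. R f \<Longrightarrow> R g \<Longrightarrow> R (f * g)"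
  shows "R g"
proof -
  have mono: "R (Poly_Mapping.single m a)" for m a
  proof (induction m arbitrary: a rule: poly_mapping_induct_single)
    case zero
    show ?case using const by (simp add: mconst_def)
  next
    case (single v k)
    show ?case
    proof (induction k)
      case 0
      show ?case using const by (simp add: mconst_def)
    next
      case (Suc k)
      have "Poly_Mapping.single (Poly_Mapping.single v (Suc k)) a =
            mvar v * Poly_Mapping.single (Poly_Mapping.single v k) a"
        by (simp add: mvar_def mult_single single_add [symmetric])
      then show ?case using mult [OF var Suc] by simp
    qed
  next
    case (add m n)
    have "Poly_Mapping.single (m + n) a = Poly_Mapping.single m 1 * Poly_Mapping.single n a"
      by (simp add: mult_single)
    then show ?case using mult [OF add.IH(1) [of 1] add.IH(2) [of a]] by simp
  qed
  show ?thesis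
  proof (induction g rule: poly_mapping_induct_single)
    case zero
    show ?case using const [of 0] by (simp add: mconst_def)
  qed (simp_all add: mono add)
qed

definition monomial_value :: "(var \<Rightarrow> 'a::comm_ring_1) \<Rightarrow> (var \<Rightarrow>\<^sub>0 nat) \<Rightarrow> 'a" where
  "monomial_value \<rho> m = (\<Prod>v\<in>Poly_Mapping.keys m. \<rho> v ^ Poly_Mapping.lookup m v)"

lemma monomial_value_UNIV:
  "monomial_value \<rho> m = (\<Prod>v\<in>UNIV. \<rho> v ^ Poly_Mapping.lookup m v)"
  unfolding monomial_value_def
  by (rule prod.mono_neutral_left) (auto simp: finite_UNIV_var in_keys_iff)

lemma monomial_value_add: "monomial_value \<rho> (m + n) = monomial_value \<rho> m * monomial_value \<rho> n"
  by (simp add: monomial_value_UNIV lookup_add power_add prod.distrib)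

text \<open>
  Two evaluations are needed: at complex numbers, and at rational functions. Both are instances
  of evaluation in a commutative ring that receives the complex coefficients through a ring
  homomorphism.
\<close>

locale coefficient_hom =
  fixes c :: "complex \<Rightarrow> 'a::comm_ring_1"
  assumes c_add: "c (a + b) = c a + c b"
    and c_mult: "c (a * b) = c a * c b"
    and c_one: "c 1 = 1"
begin

lemma c_zero: "c 0 = 0"
  using c_add [of 0 0] by simp

definition peval :: "(var \<Rightarrow> 'a) \<Rightarrow> mpoly \<Rightarrow> 'a" where
  "peval \<rho> g = (\<Sum>m\<in>Poly_Mapping.keys g. c (Poly_Mapping.lookup g m) * monomial_value \<rho> m)"

lemma peval_superset:
  assumes "finite S" "Poly_Mapping.keys g \<subseteq> S"
  shows "peval \<rho> g = (\<Sum>m\<in>S. c (Poly_Mapping.lookup g m) * monomial_value \<rho> m)"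
  unfolding peval_def using assms by (intro sum.mono_neutral_left) (auto simp: c_zero in_keys_iff)

lemma peval_add: "peval \<rho> (f + g) = peval \<rho> f + peval \<rho> g"
proof -
  define S where "S = Poly_Mapping.keys f \<union> Poly_Mapping.keys g"
  have "finite S" "Poly_Mapping.keys f \<subseteq> S" "Poly_Mapping.keys g \<subseteq> S"
    "Poly_Mapping.keys (f + g) \<subseteq> S"
    using keys_add [of f g] by (auto simp: S_def)
  then show ?thesis
    by (simp add: peval_superset [of S] lookup_add c_add algebra_simps sum.distrib)
qed

lemma peval_single: "peval \<rho> (Poly_Mapping.single m a) = c a * monomial_value \<rho> m"
  by (subst peval_superset [of "{m}"]) (auto simp: lookup_single)

lemma peval_zero: "peval \<rho> 0 = 0"
  by (simp add: peval_def)

lemma peval_mult: "peval \<rho> (f * g) = peval \<rho> f * peval \<rho> g"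
proof (induction f rule: poly_mapping_induct_single)
  case (single m a)
  show ?case
    by (induction g rule: poly_mapping_induct_single)
       (simp_all add: peval_zero peval_add mult_single peval_single c_mult monomial_value_add
          algebra_simps)
qed (simp_all add: peval_zero peval_add algebra_simps)

lemma peval_mconst: "peval \<rho> (mconst a) = c a"
  by (simp add: mconst_def peval_single monomial_value_def)

lemma peval_mvar: "peval \<rho> (mvar v) = \<rho> v"
  by (simp add: mvar_def peval_single monomial_value_def c_one)

lemma peval_one: "peval \<rho> 1 = 1"
  using peval_mconst [of \<rho> 1] by (simp add: mconst_def c_one)

lemma peval_uminus: "peval \<rho> (- g) = - peval \<rho> g"
  using peval_add [of \<rho> g "- g"] by (simp add: peval_zero eq_neg_iff_add_eq_0 add.commute)

lemma peval_diff: "peval \<rho> (f - g) = peval \<rho> f - peval \<rho> g"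
  using peval_add [of \<rho> f "- g"] by (simp add: peval_uminus)

lemma peval_numeral: "peval \<rho> (numeral k) = numeral k"
  by (induction k) (simp_all only: numeral.simps peval_one peval_add)

lemma peval_power: "peval \<rho> (g ^ k) = peval \<rho> g ^ k"
  by (induction k) (simp_all add: peval_one peval_mult)

lemmas peval_simps = peval_add peval_mult peval_mconst peval_mvar peval_one peval_zero
  peval_uminus peval_diff peval_numeral peval_power

end

lemma const_add: "const (a + b) = const a + const b"
  by (simp add: const_def single_add)

lemma const_mult: "const (a * b) = const a * const b"
  by (simp add: const_def mult_single)

lemma const_1 [simp]: "const 1 = 1"
  by (simp add: const_def One_fract_def)

lemma const_0 [simp]: "const 0 = 0"
  by (simp add: const_def Zero_fract_def)

lemma const_uminus: "const (- a) = - const a"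
  by (simp add: const_def single_uminus)

lemma const_numeral [simp]: "const (numeral k) = numeral k"
  by (induction k) (simp_all only: numeral.simps const_1 const_add)

global_interpretation subst: coefficient_hom const
  defines subst = subst.peval
  by standard (simp_all add: const_add const_mult)

global_interpretation pvalue: coefficient_hom "\<lambda>a::complex. a"
  rewrites "pvalue.peval = (\<lambda>a g. poly_value g a)"
proof -
  show "coefficient_hom (\<lambda>a::complex. a)" by standard simp_all
  then interpret coefficient_hom "\<lambda>a::complex. a" .
  show "peval = (\<lambda>a g. poly_value g a)"
    by (simp add: fun_eq_iff peval_def poly_value_def monomial_value_def)
qed

section \<open>Homomorphisms of the field of rational functions\<close>

definition emb :: "mpoly \<Rightarrow> ratfun" where
  "emb g = Fract g 1"

lemma emb_simps:
  "emb (f + g) = emb f + emb g" "emb (f * g) = emb f * emb g" "emb (f - g) = emb f - emb g"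
  "emb (- f) = - emb f" "emb 0 = 0" "emb 1 = 1" "emb (mvar v) = indet v"
  "emb (mconst a) = const a"
  by (simp_all add: emb_def mvar_def mconst_def indet_def const_def Zero_fract_def One_fract_def)

lemma emb_numeral: "emb (numeral k) = numeral k"
  by (induction k) (simp_all only: numeral.simps emb_simps)

lemma emb_power: "emb (f ^ k) = emb f ^ k"
  by (induction k) (simp_all add: emb_simps)

lemma emb_eq_0_iff: "emb g = 0 \<longleftrightarrow> g = 0"
  by (simp add: emb_def Zero_fract_def eq_fract)

lemma Fract_eq_emb: "Fract n d = emb n / emb d"
  by (simp add: emb_def)

locale ratfun_hom =
  fixes \<phi> :: "ratfun \<Rightarrow> ratfun"
  assumes hom_add [simp]: "\<phi> (f + g) = \<phi> f + \<phi> g"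
    and hom_mult [simp]: "\<phi> (f * g) = \<phi> f * \<phi> g"
    and hom_const [simp]: "\<phi> (const a) = const a"
begin

lemma hom_0 [simp]: "\<phi> 0 = 0"
  using hom_const [of 0] by simp

lemma hom_1 [simp]: "\<phi> 1 = 1"
  using hom_const [of 1] by simp

lemma hom_numeral [simp]: "\<phi> (numeral k) = numeral k"
  using hom_const [of "numeral k"] by simp

lemma hom_uminus [simp]: "\<phi> (- f) = - \<phi> f"
  using hom_add [of f "- f"] by (simp add: eq_neg_iff_add_eq_0 add.commute)

lemma hom_diff [simp]: "\<phi> (f - g) = \<phi> f - \<phi> g"
  using hom_add [of f "- g"] by simp

lemma hom_power [simp]: "\<phi> (f ^ k) = \<phi> f ^ k"
  by (induction k) simp_all

lemma hom_inverse [simp]: "\<phi> (inverse f) = inverse (\<phi> f)"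
proof (cases "f = 0")
  case False
  then have "\<phi> f * \<phi> (inverse f) = 1"
    by (metis hom_1 hom_mult right_inverse)
  then show ?thesis by (metis inverse_unique)
qed simp

lemma hom_divide [simp]: "\<phi> (f / g) = \<phi> f / \<phi> g"
  by (simp add: divide_inverse)

lemma hom_eq_0_iff [simp]: "\<phi> f = 0 \<longleftrightarrow> f = 0"
proof
  assume "\<phi> f = 0"
  then have "\<phi> (f * inverse f) = 0" by simp
  then show "f = 0" by (metis hom_1 right_inverse zero_neq_one)
qed simp

end

lemma ratfun_hom_compose:
  assumes "ratfun_hom \<phi>" "ratfun_hom \<psi>"
  shows "ratfun_hom (\<phi> \<circ> \<psi>)"
  using assms by (simp add: ratfun_hom_def)

text \<open>
  The field is generated over the complex numbers by the indeterminates, so they suffice to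
  identify a homomorphism; this turns each relation of the group into finitely many identities.
\<close>

lemma ratfun_hom_eqI:
  assumes "ratfun_hom \<phi>" "ratfun_hom \<psi>" and "\<And>v. \<phi> (indet v) = \<psi> (indet v)"
  shows "\<phi> = \<psi>"
proof
  fix f :: ratfun
  interpret \<phi>: ratfun_hom \<phi> by fact
  interpret \<psi>: ratfun_hom \<psi> by fact
  have "\<phi> (emb g) = \<psi> (emb g)" for g
    by (induction g rule: mpoly_induct) (simp_all add: emb_simps assms(3))
  moreover obtain n d where "f = Fract n d" by (cases f)
  ultimately show "\<phi> f = \<psi> f" by (simp add: Fract_eq_emb)
qed

text \<open>
  The description determines a value only if the substitution is injective on polynomials;
  otherwise a denominator could be sent to \<open>0\<close>.
\<close>

definition extend :: "(var \<Rightarrow> ratfun) \<Rightarrow> ratfun \<Rightarrow> ratfun" where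
  "extend \<rho> f =
     (THE r. \<exists>n d. d \<noteq> 0 \<and> f = Fract n d \<and> r = subst \<rho> n / subst \<rho> d)"

lemma extend_Fract:
  assumes inj: "\<And>g. subst \<rho> g = 0 \<Longrightarrow> g = 0" and "d \<noteq> 0"
  shows "extend \<rho> (Fract n d) = subst \<rho> n / subst \<rho> d"
  unfolding extend_def
proof (rule the_equality)
  show "\<exists>n' d'. d' \<noteq> 0 \<and> Fract n d = Fract n' d' \<and> subst \<rho> n / subst \<rho> d = subst \<rho> n' / subst \<rho> d'"
    using \<open>d \<noteq> 0\<close> by blast
next
  fix r
  assume "\<exists>n' d'. d' \<noteq> 0 \<and> Fract n d = Fract n' d' \<and> r = subst \<rho> n' / subst \<rho> d'"
  then obtain n' d' where *: "d' \<noteq> 0" "Fract n d = Fract n' d'" "r = subst \<rho> n' / subst \<rho> d'"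
    by blast
  then have "n * d' = n' * d" using \<open>d \<noteq> 0\<close> by (simp add: eq_fract)
  then have "subst \<rho> n * subst \<rho> d' = subst \<rho> n' * subst \<rho> d"
    by (metis subst.peval_mult)
  moreover have "subst \<rho> d \<noteq> 0" "subst \<rho> d' \<noteq> 0" using inj * \<open>d \<noteq> 0\<close> by blast+
  ultimately show "r = subst \<rho> n / subst \<rho> d" using * by (simp add: frac_eq_eq)
qed

lemma ratfun_hom_extend:
  assumes inj: "\<And>g. subst \<rho> g = 0 \<Longrightarrow> g = 0"
  shows "ratfun_hom (extend \<rho>)" and "extend \<rho> (emb g) = subst \<rho> g"
proof -
  note ext = extend_Fract [OF inj]
  have nz: "subst \<rho> d \<noteq> 0" if "d \<noteq> 0" for d using inj that by blast
  show "extend \<rho> (emb g) = subst \<rho> g" for g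
    by (simp add: emb_def ext subst.peval_simps)
  show "ratfun_hom (extend \<rho>)"
  proof
    fix f g :: ratfun
    obtain n d where f: "f = Fract n d" "d \<noteq> 0" by (cases f rule: Fract_cases_nonzero)
      (auto simp: Zero_fract_def intro: that)
    obtain n' d' where g: "g = Fract n' d'" "d' \<noteq> 0" by (cases g rule: Fract_cases_nonzero)
      (auto simp: Zero_fract_def intro: that)
    show "extend \<rho> (f + g) = extend \<rho> f + extend \<rho> g"
      using f g by (simp add: ext subst.peval_simps nz add_frac_eq)
    show "extend \<rho> (f * g) = extend \<rho> f * extend \<rho> g"
      using f g by (simp add: ext subst.peval_simps nz)
  next
    fix a
    have "const a = Fract (mconst a) 1" by (simp add: const_def mconst_def)
    then show "extend \<rho> (const a) = const a" by (simp add: ext subst.peval_simps)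
  qed
qed

locale ratfun_involution = ratfun_hom +
  assumes hom_hom [simp]: "\<phi> (\<phi> f) = f"

text \<open>
  The third hypothesis says that the substitution takes \<open>v\<close> to \<open>g / h ^ k\<close> and that substituting
  once more in this fraction returns \<open>v\<close>. Such a pair \<open>k\<close>, \<open>g\<close> then exists for every polynomial in
  place of \<open>v\<close>, because sums and products preserve this property, and the second half shows that a
  polynomial with image \<open>0\<close> is \<open>0\<close>. That the square of the extension is the identity is read off in
  the same way.
\<close>

lemma ratfun_involution_extend:
  assumes "h \<noteq> 0" "subst \<rho> h \<noteq> 0"
    and "\<And>v. \<exists>k g. emb h ^ k * \<rho> v = emb g \<and> subst \<rho> g = subst \<rho> h ^ k * indet v"
  shows "ratfun_involution (extend \<rho>)" and "extend \<rho> (indet v) = \<rho> v"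
proof -
  have h: "emb h \<noteq> 0" using assms(1) by (simp add: emb_eq_0_iff)
  have ex: "\<exists>k g'. emb h ^ k * subst \<rho> g = emb g' \<and> subst \<rho> g' = subst \<rho> h ^ k * emb g" for g
  proof (induction g rule: mpoly_induct)
    case (const a)
    show ?case
      by (rule exI [of _ 0], rule exI [of _ "mconst a"]) (simp add: subst.peval_simps emb_simps)
  next
    case (var v)
    show ?case using assms(3) [of v] by (simp add: subst.peval_simps emb_simps)
  next
    case (add f g)
    then obtain k f' l g' where
      "emb h ^ k * subst \<rho> f = emb f'" "subst \<rho> f' = subst \<rho> h ^ k * emb f"
      "emb h ^ l * subst \<rho> g = emb g'" "subst \<rho> g' = subst \<rho> h ^ l * emb g"
      by blast
    then have "emb h ^ (k + l) * subst \<rho> (f + g) = emb (h ^ l * f' + h ^ k * g')"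
      "subst \<rho> (h ^ l * f' + h ^ k * g') = subst \<rho> h ^ (k + l) * emb (f + g)"
      by (simp_all add: subst.peval_simps emb_simps emb_power power_add algebra_simps
            flip: \<open>emb h ^ k * subst \<rho> f = emb f'\<close> \<open>emb h ^ l * subst \<rho> g = emb g'\<close>)
    then show ?case by blast
  next
    case (mult f g)
    then obtain k f' l g' where
      "emb h ^ k * subst \<rho> f = emb f'" "subst \<rho> f' = subst \<rho> h ^ k * emb f"
      "emb h ^ l * subst \<rho> g = emb g'" "subst \<rho> g' = subst \<rho> h ^ l * emb g"
      by blast
    then have "emb h ^ (k + l) * subst \<rho> (f * g) = emb (f' * g')"
      "subst \<rho> (f' * g') = subst \<rho> h ^ (k + l) * emb (f * g)"
      by (simp_all add: subst.peval_simps emb_simps power_add algebra_simps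
            flip: \<open>emb h ^ k * subst \<rho> f = emb f'\<close> \<open>emb h ^ l * subst \<rho> g = emb g'\<close>)
    then show ?case by blast
  qed
  have inj: "g = 0" if "subst \<rho> g = 0" for g
  proof -
    obtain k g' where g': "emb h ^ k * subst \<rho> g = emb g'" "subst \<rho> g' = subst \<rho> h ^ k * emb g"
      using ex by blast
    then have "g' = 0" using that by (simp add: emb_eq_0_iff [symmetric])
    then show ?thesis using g'(2) assms(2) by (simp add: subst.peval_simps emb_eq_0_iff)
  qed
  note ext = ratfun_hom_extend [of \<rho>, OF inj]
  interpret ratfun_hom "extend \<rho>" by (rule ext)
  show indet: "extend \<rho> (indet v) = \<rho> v" for v
    using ext(2) [of "mvar v"] by (simp add: emb_simps subst.peval_simps)
  have "extend \<rho> (\<rho> v) = indet v" for v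
  proof -
    obtain k g where g: "emb h ^ k * \<rho> v = emb g" "subst \<rho> g = subst \<rho> h ^ k * indet v"
      using assms(3) by blast
    have "extend \<rho> (emb h ^ k * \<rho> v) = subst \<rho> h ^ k * indet v"
      using g ext(2) by simp
    then show ?thesis using assms(2) by (simp add: ext(2))
  qed
  then have "extend \<rho> \<circ> extend \<rho> = id"
    by (intro ratfun_hom_eqI ratfun_hom_compose ext) (simp_all add: indet ratfun_hom_def)
  then show "ratfun_involution (extend \<rho>)"
    by unfold_locales (simp add: fun_eq_iff)
qed

section \<open>Values of rational functions\<close>

definition has_value :: "ratfun \<Rightarrow> (var \<Rightarrow> complex) \<Rightarrow> complex \<Rightarrow> bool" where
  "has_value f a c \<longleftrightarrow>
     (\<exists>n d. f = Fract n d \<and> poly_value d a \<noteq> 0 \<and> c = poly_value n a / poly_value d a)"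

lemma poly_value_0: "poly_value 0 a = 0"
  by (simp add: pvalue.peval_zero)

lemma has_value_unique:
  assumes "has_value f a c" "has_value f a c'"
  shows "c = c'"
proof -
  obtain n d n' d' where *: "f = Fract n d" "poly_value d a \<noteq> 0" "c = poly_value n a / poly_value d a"
    "f = Fract n' d'" "poly_value d' a \<noteq> 0" "c' = poly_value n' a / poly_value d' a"
    using assms unfolding has_value_def by blast
  then have "d \<noteq> 0" "d' \<noteq> 0" by (auto simp: poly_value_0)
  with * have "n * d' = n' * d" by (simp add: eq_fract)
  then have "poly_value n a * poly_value d' a = poly_value n' a * poly_value d a"
    by (metis pvalue.peval_mult)
  then show ?thesis using * by (simp add: frac_eq_eq)
qed

lemma value_at_eq: "has_value f a c \<Longrightarrow> value_at f a = c"
  unfolding value_at_def has_value_def [symmetric] by (blast intro: has_value_unique)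

lemma regular_at_iff_has_value: "regular_at f a \<longleftrightarrow> (\<exists>c. has_value f a c)"
  unfolding regular_at_def has_value_def by blast

lemma has_value_const: "has_value (const b) a b"
  unfolding has_value_def
  by (rule exI [of _ "mconst b"], rule exI [of _ 1])
     (simp add: const_def mconst_def pvalue.peval_simps [unfolded mconst_def])

lemma has_value_indet: "has_value (indet v) a (a v)"
proof -
  have "indet v = Fract (mvar v) 1" by (simp add: indet_def mvar_def)
  moreover have "poly_value (mvar v) a = a v" "poly_value 1 a \<noteq> 0" "poly_value 1 a = 1"
    by (simp_all add: pvalue.peval_simps)
  ultimately show ?thesis unfolding has_value_def
    by (metis div_by_1)
qed

lemma has_value_add:
  assumes "has_value f a b" "has_value g a c"
  shows "has_value (f + g) a (b + c)"
proof -
  obtain n d n' d' where *: "f = Fract n d" "poly_value d a \<noteq> 0" "b = poly_value n a / poly_value d a"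
    "g = Fract n' d'" "poly_value d' a \<noteq> 0" "c = poly_value n' a / poly_value d' a"
    using assms unfolding has_value_def by blast
  then have "d \<noteq> 0" "d' \<noteq> 0" by (auto simp: poly_value_0)
  then show ?thesis unfolding has_value_def using *
    by (intro exI [of _ "n * d' + n' * d"] exI [of _ "d * d'"])
       (simp add: pvalue.peval_simps add_frac_eq)
qed

lemma has_value_mult:
  assumes "has_value f a b" "has_value g a c"
  shows "has_value (f * g) a (b * c)"
proof -
  obtain n d n' d' where "f = Fract n d" "poly_value d a \<noteq> 0" "b = poly_value n a / poly_value d a"
    "g = Fract n' d'" "poly_value d' a \<noteq> 0" "c = poly_value n' a / poly_value d' a"
    using assms unfolding has_value_def by blast
  then show ?thesis unfolding has_value_def
    by (intro exI [of _ "n * n'"] exI [of _ "d * d'"]) (simp add: pvalue.peval_simps)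
qed

lemma has_value_inverse:
  assumes "has_value f a b" "b \<noteq> 0"
  shows "has_value (inverse f) a (inverse b)"
proof -
  obtain n d where "f = Fract n d" "poly_value d a \<noteq> 0" "b = poly_value n a / poly_value d a"
    using assms unfolding has_value_def by blast
  then show ?thesis unfolding has_value_def using \<open>b \<noteq> 0\<close>
    by (intro exI [of _ d] exI [of _ n]) simp
qed

lemma has_value_divide:
  "has_value f a b \<Longrightarrow> has_value g a c \<Longrightarrow> c \<noteq> 0 \<Longrightarrow> has_value (f / g) a (b / c)"
  by (simp add: divide_inverse has_value_mult has_value_inverse)

lemma has_value_uminus: "has_value f a b \<Longrightarrow> has_value (- f) a (- b)"
  using has_value_mult [OF has_value_const [of "- 1"]] by (fastforce simp: const_uminus)

lemma has_value_diff: "has_value f a b \<Longrightarrow> has_value g a c \<Longrightarrow> has_value (f - g) a (b - c)"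
  using has_value_add [OF _ has_value_uminus] by fastforce

lemma has_value_1: "has_value 1 a 1"
  using has_value_const [of 1] by simp

lemma has_value_numeral: "has_value (numeral k) a (numeral k)"
  using has_value_const [of "numeral k"] by simp

lemma has_value_power: "has_value f a b \<Longrightarrow> has_value (f ^ k) a (b ^ k)"
  by (induction k) (simp_all add: has_value_1 has_value_mult)

lemmas has_value_intros = has_value_indet has_value_1 has_value_numeral has_value_add
  has_value_diff has_value_uminus has_value_mult has_value_divide has_value_power

lemma has_value_eqI: "has_value f a b \<Longrightarrow> b = c \<Longrightarrow> has_value f a c"
  by simp

lemma nonzero_if_value_nonzero: "has_value f a c \<Longrightarrow> c \<noteq> 0 \<Longrightarrow> f \<noteq> 0"
  using has_value_unique [of 0 a c 0] has_value_const [of 0 a] by auto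

lemma isCont_poly_value: "isCont (\<lambda>s. poly_value g (a(v := a v + s))) r"
proof (induction g rule: mpoly_induct)
  case (var u)
  show ?case by (cases "u = v") (simp_all add: pvalue.peval_simps)
qed (simp_all add: pvalue.peval_simps)

lemma eventually_regular_at:
  assumes "regular_at f a"
  shows "\<forall>\<^sub>F s in at 0. regular_at f (a(v := a v + s))"
proof -
  obtain n d where f: "f = Fract n d" "poly_value d a \<noteq> 0"
    using assms unfolding regular_at_def by blast
  have "((\<lambda>s. poly_value d (a(v := a v + s))) \<longlongrightarrow> poly_value d a) (at 0)"
    using isCont_poly_value [where g = d and a = a and v = v and r = 0] by (simp add: isCont_def)
  then have "\<forall>\<^sub>F s in at 0. poly_value d (a(v := a v + s)) \<noteq> 0"
    using f(2) by (rule tendsto_imp_eventually_ne)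
  then show ?thesis
    by (rule eventually_mono) (use f(1) in \<open>auto simp: regular_at_def\<close>)
qed

text \<open>
  If \<open>h\<close> vanished at \<open>a\<close> then \<open>g = f * h\<close> would have to vanish wherever \<open>h\<close> does and \<open>f\<close> is regular, in
  particular when the coordinate \<open>v\<close>, on which \<open>h\<close> does not depend, is moved slightly away from \<open>a v\<close>.
  It suffices that \<open>g\<close>, if it vanishes at \<open>a\<close>, vanishes at no other of these points. With a
  parameter as \<open>v\<close> this applies to quotients whose numerator and denominator both vanish at \<open>a\<close>.
\<close>

lemma denominator_nonzero:
  assumes reg: "regular_at f a" and "f * h = g"
    and h: "\<And>s. has_value h (a(v := a v + s)) c"
    and g: "\<And>s. has_value g (a(v := a v + s)) (u s)"
    and u: "\<And>s. c = 0 \<Longrightarrow> u 0 = 0 \<Longrightarrow> s \<noteq> 0 \<Longrightarrow> u s \<noteq> 0"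
  shows "c \<noteq> 0"
proof
  assume "c = 0"
  have zero: "u s = 0" if "regular_at f (a(v := a v + s))" for s
  proof -
    obtain r where "has_value f (a(v := a v + s)) r"
      using \<open>regular_at f (a(v := a v + s))\<close> regular_at_iff_has_value by blast
    then have "has_value g (a(v := a v + s)) (r * c)"
      using has_value_mult [OF _ h] \<open>f * h = g\<close> by blast
    then show ?thesis using g has_value_unique \<open>c = 0\<close> by fastforce
  qed
  have "\<forall>\<^sub>F s in at 0. s \<noteq> (0::complex) \<and> regular_at f (a(v := a v + s))"
    using eventually_regular_at [OF reg]
    by (simp add: eventually_conj_iff eventually_neq_at_within)
  then obtain s where "s \<noteq> 0" "regular_at f (a(v := a v + s))"
    using eventually_happens' [of "at (0::complex)"] by (auto simp: at_neq_bot)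
  moreover have "u 0 = 0" using zero [of 0] reg by simp
  ultimately show False using u zero \<open>c = 0\<close> by blast
qed

section \<open>The vector field\<close>

lemma deriv_hamiltonian:
  "deriv (\<lambda>\<eta>. hamiltonian \<alpha> x \<eta> z w q p t) y =
       (2 * x^2 * y + 2 * \<alpha> 0 * x + t + 2 * z * (z * w + \<alpha> 2) - 2 * p) / t"
    "deriv (\<lambda>\<xi>. hamiltonian \<alpha> \<xi> y z w q p t) x = (2 * x * y^2 + 2 * \<alpha> 0 * y + 1) / t"
    "deriv (\<lambda>\<eta>. hamiltonian \<alpha> x y z \<eta> q p t) w =
       (2 * z^2 * w + 2 * (\<alpha> 0 + \<alpha> 1 + \<alpha> 2) * z + t + 2 * y * z^2 - 2 * p) / t"
    "deriv (\<lambda>\<xi>. hamiltonian \<alpha> x y \<xi> w q p t) z =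
       (2 * z * w^2 + 2 * (\<alpha> 0 + \<alpha> 1 + \<alpha> 2) * w + 4 * y * z * w + 2 * \<alpha> 2 * y) / t"
    "deriv (\<lambda>\<eta>. hamiltonian \<alpha> x y z w q \<eta> t) p =
       (2 * q^2 * p - t * q^2 + (\<alpha> 4 + \<alpha> 5 - 1) * q - 2 * (y + w)) / t"
    "deriv (\<lambda>\<xi>. hamiltonian \<alpha> x y z w \<xi> p t) q =
       (2 * q * p^2 - 2 * t * q * p + (\<alpha> 4 + \<alpha> 5 - 1) * p - \<alpha> 4 * t) / t"
  unfolding hamiltonian_def
  by ((rule DERIV_imp_deriv, rule DERIV_cdivide,
      (rule derivative_eq_intros refl)+, simp add: algebra_simps power2_eq_square); fail)+

lemma solves_iff:
  "solves \<alpha> U x y z w q p \<longleftrightarrow>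
     admissible_parameters \<alpha> \<and> open U \<and> 0 \<notin> U \<and>
     (\<forall>t\<in>U.
       (x has_field_derivative
          (2 * x t^2 * y t + 2 * \<alpha> 0 * x t + t + 2 * z t * (z t * w t + \<alpha> 2) - 2 * p t) / t) (at t) \<and>
       (y has_field_derivative - ((2 * x t * y t^2 + 2 * \<alpha> 0 * y t + 1) / t)) (at t) \<and>
       (z has_field_derivative
          (2 * z t^2 * w t + 2 * (\<alpha> 0 + \<alpha> 1 + \<alpha> 2) * z t + t + 2 * y t * z t^2 - 2 * p t) / t) (at t) \<and>
       (w has_field_derivative
          - ((2 * z t * w t^2 + 2 * (\<alpha> 0 + \<alpha> 1 + \<alpha> 2) * w t + 4 * y t * z t * w t
              + 2 * \<alpha> 2 * y t) / t)) (at t) \<and>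
       (q has_field_derivative
          (2 * q t^2 * p t - t * q t^2 + (\<alpha> 4 + \<alpha> 5 - 1) * q t - 2 * (y t + w t)) / t) (at t) \<and>
       (p has_field_derivative
          - ((2 * q t * p t^2 - 2 * t * q t * p t + (\<alpha> 4 + \<alpha> 5 - 1) * p t - \<alpha> 4 * t) / t)) (at t))"
  by (simp add: solves_def deriv_hamiltonian)

lemma solves_cong:
  assumes "solves \<alpha> U x y z w q p" and "\<And>i. i \<le> 5 \<Longrightarrow> \<alpha>' i = \<alpha> i"
    and eq: "\<And>t. t \<in> U \<Longrightarrow> x' t = x t \<and> y' t = y t \<and> z' t = z t \<and> w' t = w t \<and> q' t = q t \<and> p' t = p t"
  shows "solves \<alpha>' U x' y' z' w' q' p'"
proof -
  have "open U" using assms(1) by (simp add: solves_def)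
  have transfer: "(g has_field_derivative D) (at t)"
    if "(f has_field_derivative D) (at t)" "t \<in> U" "\<And>t. t \<in> U \<Longrightarrow> g t = f t" for f g D t
    using has_field_derivative_transform_within_open [OF that(1) \<open>open U\<close> that(2)] that(3) by simp
  have "admissible_parameters \<alpha>'" "open U" "0 \<notin> U"
    using assms(1,2) by (simp_all add: solves_def admissible_parameters_def)
  then show ?thesis
    unfolding solves_iff using assms(1) [unfolded solves_iff]
    by (auto simp: assms(2) eq elim!: transfer)
qed

section \<open>Action on solutions\<close>

text \<open>
  The generator \<open>s\<^sub>k\<close> acts on the parameters by \<open>\<alpha>\<^sub>i \<mapsto> \<alpha>\<^sub>i + r\<^sub>k\<^sub>i \<alpha>\<^sub>k\<close>, where the integers \<open>r\<^sub>k\<^sub>i\<close>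
  are, up to sign, the entries of the Cartan matrix.
\<close>

definition reflection_coeff :: "nat \<Rightarrow> nat \<Rightarrow> complex" where
  "reflection_coeff k i =
     [[-2, 2, 0, 0, 0, 0],
      [1, -2, 1, 0, 0, 0],
      [0, 1, -2, 1, 0, 0],
      [0, 0, 1, -2, 1, 1],
      [0, 0, 0, 1, -2, 0],
      [0, 0, 0, 1, 0, -2]] ! k ! i"

text \<open>
  The normalisation of the parameters pairs to \<open>0\<close> with every row of the Cartan matrix, as the
  null root of the affine root system does.
\<close>

lemma admissible_reflection:
  assumes "admissible_parameters \<alpha>" "k \<le> 5"
  shows "admissible_parameters (\<lambda>i. \<alpha> i + reflection_coeff k i * \<alpha> k)"
proof -
  let ?r = "reflection_coeff k"
  have "k \<in> {0, 1, 2, 3, 4, 5}" using \<open>k \<le> 5\<close> by auto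
  then have "2 * ?r 0 + 2 * ?r 1 + 2 * ?r 2 + 2 * ?r 3 + ?r 4 + ?r 5 = 0"
    by (auto simp: reflection_coeff_def)
  then show ?thesis using assms(1) unfolding admissible_parameters_def by algebra
qed

lemma solves_timeD:
  assumes "solves \<alpha> U x y z w q p" "t \<in> U"
  shows "t \<noteq> 0" and "\<alpha> 5 = 1 - 2 * \<alpha> 0 - 2 * \<alpha> 1 - 2 * \<alpha> 2 - 2 * \<alpha> 3 - \<alpha> 4"
    and "(x has_field_derivative
          (2 * x t^2 * y t + 2 * \<alpha> 0 * x t + t + 2 * z t * (z t * w t + \<alpha> 2) - 2 * p t) / t) (at t)"
    and "(y has_field_derivative - ((2 * x t * y t^2 + 2 * \<alpha> 0 * y t + 1) / t)) (at t)"
    and "(z has_field_derivative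
          (2 * z t^2 * w t + 2 * (\<alpha> 0 + \<alpha> 1 + \<alpha> 2) * z t + t + 2 * y t * z t^2 - 2 * p t) / t) (at t)"
    and "(w has_field_derivative
          - ((2 * z t * w t^2 + 2 * (\<alpha> 0 + \<alpha> 1 + \<alpha> 2) * w t + 4 * y t * z t * w t
              + 2 * \<alpha> 2 * y t) / t)) (at t)"
    and "(q has_field_derivative
          (2 * q t^2 * p t - t * q t^2 + (\<alpha> 4 + \<alpha> 5 - 1) * q t - 2 * (y t + w t)) / t) (at t)"
    and "(p has_field_derivative
          - ((2 * q t * p t^2 - 2 * t * q t * p t + (\<alpha> 4 + \<alpha> 5 - 1) * p t - \<alpha> 4 * t) / t)) (at t)"
proof -
  have "2 * \<alpha> 0 + 2 * \<alpha> 1 + 2 * \<alpha> 2 + 2 * \<alpha> 3 + \<alpha> 4 + \<alpha> 5 = 1"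
    using assms(1) by (simp add: solves_def admissible_parameters_def)
  then show "\<alpha> 5 = 1 - 2 * \<alpha> 0 - 2 * \<alpha> 1 - 2 * \<alpha> 2 - 2 * \<alpha> 3 - \<alpha> 4"
    by algebra
qed (use assms in \<open>auto simp: solves_iff\<close>)

text \<open>
  For \<open>\<epsilon> = -1\<close> the factor from the chain rule and the sign in the denominator of the vector field
  at time \<open>\<epsilon> * t\<close> cancel. Only the explicit occurrences of the time in the numerators change sign,
  so it suffices to check derivatives at the original time \<open>t\<close>.
\<close>

lemma solves_rescaledI:
  assumes \<epsilon>: "\<epsilon> \<in> {1, -1}" and adm: "admissible_parameters \<alpha>" and U: "open U" "0 \<notin> U"
    and dx: "\<And>t. t \<in> U \<Longrightarrow> (x has_field_derivative
        (2 * x t^2 * y t + 2 * \<alpha> 0 * x t + \<epsilon> * t + 2 * z t * (z t * w t + \<alpha> 2) - 2 * p t) / t) (at t)"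
    and dy: "\<And>t. t \<in> U \<Longrightarrow> (y has_field_derivative
        - ((2 * x t * y t^2 + 2 * \<alpha> 0 * y t + 1) / t)) (at t)"
    and dz: "\<And>t. t \<in> U \<Longrightarrow> (z has_field_derivative
        (2 * z t^2 * w t + 2 * (\<alpha> 0 + \<alpha> 1 + \<alpha> 2) * z t + \<epsilon> * t + 2 * y t * z t^2 - 2 * p t) / t) (at t)"
    and dw: "\<And>t. t \<in> U \<Longrightarrow> (w has_field_derivative
        - ((2 * z t * w t^2 + 2 * (\<alpha> 0 + \<alpha> 1 + \<alpha> 2) * w t + 4 * y t * z t * w t
            + 2 * \<alpha> 2 * y t) / t)) (at t)"
    and dq: "\<And>t. t \<in> U \<Longrightarrow> (q has_field_derivative
        (2 * q t^2 * p t - \<epsilon> * t * q t^2 + (\<alpha> 4 + \<alpha> 5 - 1) * q t - 2 * (y t + w t)) / t) (at t)"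
    and dp: "\<And>t. t \<in> U \<Longrightarrow> (p has_field_derivative
        - ((2 * q t * p t^2 - 2 * (\<epsilon> * t) * q t * p t + (\<alpha> 4 + \<alpha> 5 - 1) * p t - \<alpha> 4 * (\<epsilon> * t)) / t)) (at t)"
  shows "solves \<alpha> ((*) \<epsilon> ` U) (\<lambda>\<tau>. x (\<epsilon> * \<tau>)) (\<lambda>\<tau>. y (\<epsilon> * \<tau>)) (\<lambda>\<tau>. z (\<epsilon> * \<tau>))
    (\<lambda>\<tau>. w (\<epsilon> * \<tau>)) (\<lambda>\<tau>. q (\<epsilon> * \<tau>)) (\<lambda>\<tau>. p (\<epsilon> * \<tau>))"
proof -
  have \<epsilon>2: "\<epsilon> * (\<epsilon> * r) = r" "\<epsilon> \<noteq> 0" for r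
    using \<epsilon> by auto
  have chain: "((\<lambda>\<tau>. f (\<epsilon> * \<tau>)) has_field_derivative D') (at (\<epsilon> * t))"
    if "(f has_field_derivative D) (at t)" "D' = D * \<epsilon>"
    for f :: "complex \<Rightarrow> complex" and D D' t
  proof -
    have "(f has_field_derivative D) (at (\<epsilon> * (\<epsilon> * t)))" using that(1) by (simp add: \<epsilon>2)
    from DERIV_chain2 [OF this DERIV_cmult [OF DERIV_ident]] show ?thesis using that(2) by simp
  qed
  have open_image: "open ((*) \<epsilon> ` U)"
    using \<epsilon> open_negations [OF U(1)] U(1) by (auto simp: image_def)
  have no_zero: "0 \<notin> (*) \<epsilon> ` U"
    using U(2) \<epsilon>2(2) by (metis imageE mult_eq_0_iff)
  show ?thesis
    unfolding solves_iff
  proof (intro conjI ballI, goal_cases)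
    case 1 show ?case by (rule adm)
  next
    case 2 show ?case by (rule open_image)
  next
    case 3 show ?case by (rule no_zero)
  next
    case (4 \<tau>) then obtain t where t: "\<tau> = \<epsilon> * t" "t \<in> U" "t \<noteq> 0" using U(2) by blast
    show ?case unfolding t(1) by (rule chain [OF dx [OF t(2)]]) (use \<epsilon> t(3) in \<open>auto simp: field_simps\<close>)
  next
    case (5 \<tau>) then obtain t where t: "\<tau> = \<epsilon> * t" "t \<in> U" "t \<noteq> 0" using U(2) by blast
    show ?case unfolding t(1) by (rule chain [OF dy [OF t(2)]]) (use \<epsilon> t(3) in \<open>auto simp: field_simps\<close>)
  next
    case (6 \<tau>) then obtain t where t: "\<tau> = \<epsilon> * t" "t \<in> U" "t \<noteq> 0" using U(2) by blast
    show ?case unfolding t(1) by (rule chain [OF dz [OF t(2)]]) (use \<epsilon> t(3) in \<open>auto simp: field_simps\<close>)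
  next
    case (7 \<tau>) then obtain t where t: "\<tau> = \<epsilon> * t" "t \<in> U" "t \<noteq> 0" using U(2) by blast
    show ?case unfolding t(1) by (rule chain [OF dw [OF t(2)]]) (use \<epsilon> t(3) in \<open>auto simp: field_simps\<close>)
  next
    case (8 \<tau>) then obtain t where t: "\<tau> = \<epsilon> * t" "t \<in> U" "t \<noteq> 0" using U(2) by blast
    show ?case unfolding t(1) by (rule chain [OF dq [OF t(2)]]) (use \<epsilon> t(3) in \<open>auto simp: field_simps\<close>)
  next
    case (9 \<tau>) then obtain t where t: "\<tau> = \<epsilon> * t" "t \<in> U" "t \<noteq> 0" using U(2) by blast
    show ?case unfolding t(1) by (rule chain [OF dp [OF t(2)]]) (use \<epsilon> t(3) in \<open>auto simp: field_simps\<close>)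
  qed
qed

lemma solves_s0:
  assumes sol: "solves \<alpha> U x y z w q p" and nz: "\<And>t. t \<in> U \<Longrightarrow> y t \<noteq> 0"
  shows "solves (\<lambda>i. \<alpha> i + reflection_coeff 0 i * \<alpha> 0) ((*) (- 1) ` U)
    (\<lambda>\<tau>. - x (- 1 * \<tau>) - 2 * \<alpha> 0 / y (- 1 * \<tau>) - 1 / (y (- 1 * \<tau>))^2)
    (\<lambda>\<tau>. - y (- 1 * \<tau>))
    (\<lambda>\<tau>. - z (- 1 * \<tau>))
    (\<lambda>\<tau>. - w (- 1 * \<tau>))
    (\<lambda>\<tau>. - q (- 1 * \<tau>))
    (\<lambda>\<tau>. - p (- 1 * \<tau>))"
proof (rule solves_rescaledI, goal_cases)
  case 2 show ?case
    using sol by (intro admissible_reflection) (simp_all add: solves_iff)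
next
  case (5 t) note D = solves_timeD [OF sol 5] and nz = nz [OF 5]
  show ?case
    by (rule DERIV_cong [OF DERIV_diff [OF DERIV_diff [OF DERIV_minus [OF D(3)] DERIV_divide [OF DERIV_const D(4) nz]] DERIV_divide [OF DERIV_const DERIV_power [OF D(4)] power_not_zero [OF nz]]]])
      (use D(1) nz in \<open>simp add: D(2) reflection_coeff_def field_simps power2_eq_square\<close>)
next
  case (6 t) note D = solves_timeD [OF sol 6] and nz = nz [OF 6]
  show ?case
    by (rule DERIV_cong [OF DERIV_minus [OF D(4)]])
      (use D(1) nz in \<open>simp add: D(2) reflection_coeff_def field_simps power2_eq_square\<close>)
next
  case (7 t) note D = solves_timeD [OF sol 7] and nz = nz [OF 7]
  show ?case
    by (rule DERIV_cong [OF DERIV_minus [OF D(5)]])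
      (use D(1) nz in \<open>simp add: D(2) reflection_coeff_def field_simps power2_eq_square\<close>)
next
  case (8 t) note D = solves_timeD [OF sol 8] and nz = nz [OF 8]
  show ?case
    by (rule DERIV_cong [OF DERIV_minus [OF D(6)]])
      (use D(1) nz in \<open>simp add: D(2) reflection_coeff_def field_simps power2_eq_square\<close>)
next
  case (9 t) note D = solves_timeD [OF sol 9] and nz = nz [OF 9]
  show ?case
    by (rule DERIV_cong [OF DERIV_minus [OF D(7)]])
      (use D(1) nz in \<open>simp add: D(2) reflection_coeff_def field_simps power2_eq_square\<close>)
next
  case (10 t) note D = solves_timeD [OF sol 10] and nz = nz [OF 10]
  show ?case
    by (rule DERIV_cong [OF DERIV_minus [OF D(8)]])
      (use D(1) nz in \<open>simp add: D(2) reflection_coeff_def field_simps power2_eq_square\<close>)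
qed (use sol in \<open>simp_all add: solves_iff\<close>)

text \<open>
  Each component is a rational identity. The denominator is kept as an opaque quantity \<open>e\<close> while
  the fractions are cleared and is expanded only afterwards; expanding it first would hide from
  the simplifier that its square is nonzero.
\<close>

lemma solves_s1:
  assumes sol: "solves \<alpha> U x y z w q p" and nz: "\<And>t. t \<in> U \<Longrightarrow> x t - z t \<noteq> 0"
  shows "solves (\<lambda>i. \<alpha> i + reflection_coeff 1 i * \<alpha> 1) ((*) (1) ` U)
    (\<lambda>\<tau>. x (1 * \<tau>))
    (\<lambda>\<tau>. y (1 * \<tau>) - \<alpha> 1 / (x (1 * \<tau>) - z (1 * \<tau>)))
    (\<lambda>\<tau>. z (1 * \<tau>))
    (\<lambda>\<tau>. w (1 * \<tau>) + \<alpha> 1 / (x (1 * \<tau>) - z (1 * \<tau>)))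
    (\<lambda>\<tau>. q (1 * \<tau>))
    (\<lambda>\<tau>. p (1 * \<tau>))"
proof (rule solves_rescaledI, goal_cases)
  case 2 show ?case
    using sol by (intro admissible_reflection) (simp_all add: solves_iff)
next
  case (5 t) note D = solves_timeD [OF sol 5] and nz = nz [OF 5]
  define e where "e = x t - z t"
  have e: "e \<noteq> 0" using nz by (simp add: e_def)
  show ?case
    by (rule DERIV_cong [OF D(3)])
      ((unfold e_def [symmetric])?,
       (use D(1) e in \<open>simp add: D(2) reflection_coeff_def divide_simps\<close>);
        simp add: e_def algebra_simps power2_eq_square)
next
  case (6 t) note D = solves_timeD [OF sol 6] and nz = nz [OF 6]
  define e where "e = x t - z t"
  have e: "e \<noteq> 0" using nz by (simp add: e_def)
  show ?case
    by (rule DERIV_cong [OF DERIV_diff [OF D(4) DERIV_divide [OF DERIV_const DERIV_diff [OF D(3,5)] nz]]])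
      ((unfold e_def [symmetric])?,
       (use D(1) e in \<open>simp add: D(2) reflection_coeff_def divide_simps\<close>);
        simp add: e_def algebra_simps power2_eq_square)
next
  case (7 t) note D = solves_timeD [OF sol 7] and nz = nz [OF 7]
  define e where "e = x t - z t"
  have e: "e \<noteq> 0" using nz by (simp add: e_def)
  show ?case
    by (rule DERIV_cong [OF D(5)])
      ((unfold e_def [symmetric])?,
       (use D(1) e in \<open>simp add: D(2) reflection_coeff_def divide_simps\<close>);
        simp add: e_def algebra_simps power2_eq_square)
next
  case (8 t) note D = solves_timeD [OF sol 8] and nz = nz [OF 8]
  define e where "e = x t - z t"
  have e: "e \<noteq> 0" using nz by (simp add: e_def)
  show ?case
    by (rule DERIV_cong [OF DERIV_add [OF D(6) DERIV_divide [OF DERIV_const DERIV_diff [OF D(3,5)] nz]]])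
      ((unfold e_def [symmetric])?,
       (use D(1) e in \<open>simp add: D(2) reflection_coeff_def divide_simps\<close>);
        simp add: e_def algebra_simps power2_eq_square)
next
  case (9 t) note D = solves_timeD [OF sol 9] and nz = nz [OF 9]
  define e where "e = x t - z t"
  have e: "e \<noteq> 0" using nz by (simp add: e_def)
  show ?case
    by (rule DERIV_cong [OF D(7)])
      ((unfold e_def [symmetric])?,
       (use D(1) e in \<open>simp add: D(2) reflection_coeff_def divide_simps\<close>);
        simp add: e_def algebra_simps power2_eq_square)
next
  case (10 t) note D = solves_timeD [OF sol 10] and nz = nz [OF 10]
  define e where "e = x t - z t"
  have e: "e \<noteq> 0" using nz by (simp add: e_def)
  show ?case
    by (rule DERIV_cong [OF D(8)])
      ((unfold e_def [symmetric])?,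
       (use D(1) e in \<open>simp add: D(2) reflection_coeff_def divide_simps\<close>);
        simp add: e_def algebra_simps power2_eq_square)
qed (use sol in \<open>simp_all add: solves_iff\<close>)

lemma solves_s2:
  assumes sol: "solves \<alpha> U x y z w q p" and nz: "\<And>t. t \<in> U \<Longrightarrow> w t \<noteq> 0"
  shows "solves (\<lambda>i. \<alpha> i + reflection_coeff 2 i * \<alpha> 2) ((*) (1) ` U)
    (\<lambda>\<tau>. x (1 * \<tau>))
    (\<lambda>\<tau>. y (1 * \<tau>))
    (\<lambda>\<tau>. z (1 * \<tau>) + \<alpha> 2 / w (1 * \<tau>))
    (\<lambda>\<tau>. w (1 * \<tau>))
    (\<lambda>\<tau>. q (1 * \<tau>))
    (\<lambda>\<tau>. p (1 * \<tau>))"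
proof (rule solves_rescaledI, goal_cases)
  case 2 show ?case
    using sol by (intro admissible_reflection) (simp_all add: solves_iff)
next
  case (5 t) note D = solves_timeD [OF sol 5] and nz = nz [OF 5]
  show ?case
    by (rule DERIV_cong [OF D(3)])
      (use D(1) nz in \<open>simp add: D(2) reflection_coeff_def field_simps power2_eq_square\<close>)
next
  case (6 t) note D = solves_timeD [OF sol 6] and nz = nz [OF 6]
  show ?case
    by (rule DERIV_cong [OF D(4)])
      (use D(1) nz in \<open>simp add: D(2) reflection_coeff_def field_simps power2_eq_square\<close>)
next
  case (7 t) note D = solves_timeD [OF sol 7] and nz = nz [OF 7]
  show ?case
    by (rule DERIV_cong [OF DERIV_add [OF D(5) DERIV_divide [OF DERIV_const D(6) nz]]])
      (use D(1) nz in \<open>simp add: D(2) reflection_coeff_def field_simps power2_eq_square\<close>)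
next
  case (8 t) note D = solves_timeD [OF sol 8] and nz = nz [OF 8]
  show ?case
    by (rule DERIV_cong [OF D(6)])
      (use D(1) nz in \<open>simp add: D(2) reflection_coeff_def field_simps power2_eq_square\<close>)
next
  case (9 t) note D = solves_timeD [OF sol 9] and nz = nz [OF 9]
  show ?case
    by (rule DERIV_cong [OF D(7)])
      (use D(1) nz in \<open>simp add: D(2) reflection_coeff_def field_simps power2_eq_square\<close>)
next
  case (10 t) note D = solves_timeD [OF sol 10] and nz = nz [OF 10]
  show ?case
    by (rule DERIV_cong [OF D(8)])
      (use D(1) nz in \<open>simp add: D(2) reflection_coeff_def field_simps power2_eq_square\<close>)
qed (use sol in \<open>simp_all add: solves_iff\<close>)

lemma solves_s3:
  assumes sol: "solves \<alpha> U x y z w q p" and nz: "\<And>t. t \<in> U \<Longrightarrow> z t * q t - 1 \<noteq> 0"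
  shows "solves (\<lambda>i. \<alpha> i + reflection_coeff 3 i * \<alpha> 3) ((*) (1) ` U)
    (\<lambda>\<tau>. x (1 * \<tau>))
    (\<lambda>\<tau>. y (1 * \<tau>))
    (\<lambda>\<tau>. z (1 * \<tau>))
    (\<lambda>\<tau>. w (1 * \<tau>) - \<alpha> 3 * q (1 * \<tau>) / (z (1 * \<tau>) * q (1 * \<tau>) - 1))
    (\<lambda>\<tau>. q (1 * \<tau>))
    (\<lambda>\<tau>. p (1 * \<tau>) - \<alpha> 3 * z (1 * \<tau>) / (z (1 * \<tau>) * q (1 * \<tau>) - 1))"
proof (rule solves_rescaledI, goal_cases)
  case 2 show ?case
    using sol by (intro admissible_reflection) (simp_all add: solves_iff)
next
  case (5 t) note D = solves_timeD [OF sol 5] and nz = nz [OF 5]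
  define e where "e = z t * q t - 1"
  have e: "e \<noteq> 0" using nz by (simp add: e_def)
  show ?case
    by (rule DERIV_cong [OF D(3)])
      ((unfold e_def [symmetric])?,
       (use D(1) e in \<open>simp add: D(2) reflection_coeff_def divide_simps\<close>);
        simp add: e_def algebra_simps power2_eq_square)
next
  case (6 t) note D = solves_timeD [OF sol 6] and nz = nz [OF 6]
  define e where "e = z t * q t - 1"
  have e: "e \<noteq> 0" using nz by (simp add: e_def)
  show ?case
    by (rule DERIV_cong [OF D(4)])
      ((unfold e_def [symmetric])?,
       (use D(1) e in \<open>simp add: D(2) reflection_coeff_def divide_simps\<close>);
        simp add: e_def algebra_simps power2_eq_square)
next
  case (7 t) note D = solves_timeD [OF sol 7] and nz = nz [OF 7]
  define e where "e = z t * q t - 1"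
  have e: "e \<noteq> 0" using nz by (simp add: e_def)
  show ?case
    by (rule DERIV_cong [OF D(5)])
      ((unfold e_def [symmetric])?,
       (use D(1) e in \<open>simp add: D(2) reflection_coeff_def divide_simps\<close>);
        simp add: e_def algebra_simps power2_eq_square)
next
  case (8 t) note D = solves_timeD [OF sol 8] and nz = nz [OF 8]
  define e where "e = z t * q t - 1"
  have e: "e \<noteq> 0" using nz by (simp add: e_def)
  show ?case
    by (rule DERIV_cong [OF DERIV_diff [OF D(6) DERIV_divide [OF DERIV_cmult [OF D(7)] DERIV_diff [OF DERIV_mult [OF D(5,7)] DERIV_const] nz]]])
      ((unfold e_def [symmetric])?,
       (use D(1) e in \<open>simp add: D(2) reflection_coeff_def divide_simps\<close>);
        simp add: e_def algebra_simps power2_eq_square)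
next
  case (9 t) note D = solves_timeD [OF sol 9] and nz = nz [OF 9]
  define e where "e = z t * q t - 1"
  have e: "e \<noteq> 0" using nz by (simp add: e_def)
  show ?case
    by (rule DERIV_cong [OF D(7)])
      ((unfold e_def [symmetric])?,
       (use D(1) e in \<open>simp add: D(2) reflection_coeff_def divide_simps\<close>);
        simp add: e_def algebra_simps power2_eq_square)
next
  case (10 t) note D = solves_timeD [OF sol 10] and nz = nz [OF 10]
  define e where "e = z t * q t - 1"
  have e: "e \<noteq> 0" using nz by (simp add: e_def)
  show ?case
    by (rule DERIV_cong [OF DERIV_diff [OF D(8) DERIV_divide [OF DERIV_cmult [OF D(5)] DERIV_diff [OF DERIV_mult [OF D(5,7)] DERIV_const] nz]]])
      ((unfold e_def [symmetric])?,
       (use D(1) e in \<open>simp add: D(2) reflection_coeff_def divide_simps\<close>);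
        simp add: e_def algebra_simps power2_eq_square)
qed (use sol in \<open>simp_all add: solves_iff\<close>)

lemma solves_s4:
  assumes sol: "solves \<alpha> U x y z w q p" and nz: "\<And>t. t \<in> U \<Longrightarrow> p t \<noteq> 0"
  shows "solves (\<lambda>i. \<alpha> i + reflection_coeff 4 i * \<alpha> 4) ((*) (1) ` U)
    (\<lambda>\<tau>. x (1 * \<tau>))
    (\<lambda>\<tau>. y (1 * \<tau>))
    (\<lambda>\<tau>. z (1 * \<tau>))
    (\<lambda>\<tau>. w (1 * \<tau>))
    (\<lambda>\<tau>. q (1 * \<tau>) + \<alpha> 4 / p (1 * \<tau>))
    (\<lambda>\<tau>. p (1 * \<tau>))"
proof (rule solves_rescaledI, goal_cases)
  case 2 show ?case
    using sol by (intro admissible_reflection) (simp_all add: solves_iff)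
next
  case (5 t) note D = solves_timeD [OF sol 5] and nz = nz [OF 5]
  show ?case
    by (rule DERIV_cong [OF D(3)])
      (use D(1) nz in \<open>simp add: D(2) reflection_coeff_def field_simps power2_eq_square\<close>)
next
  case (6 t) note D = solves_timeD [OF sol 6] and nz = nz [OF 6]
  show ?case
    by (rule DERIV_cong [OF D(4)])
      (use D(1) nz in \<open>simp add: D(2) reflection_coeff_def field_simps power2_eq_square\<close>)
next
  case (7 t) note D = solves_timeD [OF sol 7] and nz = nz [OF 7]
  show ?case
    by (rule DERIV_cong [OF D(5)])
      (use D(1) nz in \<open>simp add: D(2) reflection_coeff_def field_simps power2_eq_square\<close>)
next
  case (8 t) note D = solves_timeD [OF sol 8] and nz = nz [OF 8]
  show ?case
    by (rule DERIV_cong [OF D(6)])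
      (use D(1) nz in \<open>simp add: D(2) reflection_coeff_def field_simps power2_eq_square\<close>)
next
  case (9 t) note D = solves_timeD [OF sol 9] and nz = nz [OF 9]
  show ?case
    by (rule DERIV_cong [OF DERIV_add [OF D(7) DERIV_divide [OF DERIV_const D(8) nz]]])
      (use D(1) nz in \<open>simp add: D(2) reflection_coeff_def field_simps power2_eq_square\<close>)
next
  case (10 t) note D = solves_timeD [OF sol 10] and nz = nz [OF 10]
  show ?case
    by (rule DERIV_cong [OF D(8)])
      (use D(1) nz in \<open>simp add: D(2) reflection_coeff_def field_simps power2_eq_square\<close>)
qed (use sol in \<open>simp_all add: solves_iff\<close>)

lemma solves_s5:
  assumes sol: "solves \<alpha> U x y z w q p" and nz: "\<And>t. t \<in> U \<Longrightarrow> p t - t \<noteq> 0"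
  shows "solves (\<lambda>i. \<alpha> i + reflection_coeff 5 i * \<alpha> 5) ((*) (1) ` U)
    (\<lambda>\<tau>. x (1 * \<tau>))
    (\<lambda>\<tau>. y (1 * \<tau>))
    (\<lambda>\<tau>. z (1 * \<tau>))
    (\<lambda>\<tau>. w (1 * \<tau>))
    (\<lambda>\<tau>. q (1 * \<tau>) + \<alpha> 5 / (p (1 * \<tau>) - (1 * \<tau>)))
    (\<lambda>\<tau>. p (1 * \<tau>))"
proof (rule solves_rescaledI, goal_cases)
  case 2 show ?case
    using sol by (intro admissible_reflection) (simp_all add: solves_iff)
next
  case (5 t) note D = solves_timeD [OF sol 5] and nz = nz [OF 5]
  define e where "e = p t - t"
  have e: "e \<noteq> 0" using nz by (simp add: e_def)
  show ?case
    by (rule DERIV_cong [OF D(3)])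
      ((unfold e_def [symmetric])?,
       (use D(1) e in \<open>simp add: reflection_coeff_def divide_simps\<close>);
        simp add: e_def algebra_simps power2_eq_square)
next
  case (6 t) note D = solves_timeD [OF sol 6] and nz = nz [OF 6]
  define e where "e = p t - t"
  have e: "e \<noteq> 0" using nz by (simp add: e_def)
  show ?case
    by (rule DERIV_cong [OF D(4)])
      ((unfold e_def [symmetric])?,
       (use D(1) e in \<open>simp add: reflection_coeff_def divide_simps\<close>);
        simp add: e_def algebra_simps power2_eq_square)
next
  case (7 t) note D = solves_timeD [OF sol 7] and nz = nz [OF 7]
  define e where "e = p t - t"
  have e: "e \<noteq> 0" using nz by (simp add: e_def)
  show ?case
    by (rule DERIV_cong [OF D(5)])
      ((unfold e_def [symmetric])?,
       (use D(1) e in \<open>simp add: reflection_coeff_def divide_simps\<close>);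
        simp add: e_def algebra_simps power2_eq_square)
next
  case (8 t) note D = solves_timeD [OF sol 8] and nz = nz [OF 8]
  define e where "e = p t - t"
  have e: "e \<noteq> 0" using nz by (simp add: e_def)
  show ?case
    by (rule DERIV_cong [OF D(6)])
      ((unfold e_def [symmetric])?,
       (use D(1) e in \<open>simp add: reflection_coeff_def divide_simps\<close>);
        simp add: e_def algebra_simps power2_eq_square)
next
  case (9 t) note D = solves_timeD [OF sol 9] and nz = nz [OF 9]
  define e where "e = p t - t"
  have e: "e \<noteq> 0" using nz by (simp add: e_def)
  show ?case
    by (rule DERIV_cong [OF DERIV_add [OF D(7) DERIV_divide [OF DERIV_const DERIV_diff [OF D(8) DERIV_ident] nz]]])
      ((unfold e_def [symmetric])?,
       (use D(1) e in \<open>simp add: reflection_coeff_def divide_simps\<close>);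
        simp add: e_def algebra_simps power2_eq_square)
next
  case (10 t) note D = solves_timeD [OF sol 10] and nz = nz [OF 10]
  define e where "e = p t - t"
  have e: "e \<noteq> 0" using nz by (simp add: e_def)
  show ?case
    by (rule DERIV_cong [OF D(8)])
      ((unfold e_def [symmetric])?,
       (use D(1) e in \<open>simp add: reflection_coeff_def divide_simps\<close>);
        simp add: e_def algebra_simps power2_eq_square)
qed (use sol in \<open>simp_all add: solves_iff\<close>)

text \<open>
  The divisor \<open>p = 0\<close> is invariant under the flow if \<open>\<alpha>\<^sub>4 = 0\<close>, and \<open>p = t\<close> if \<open>\<alpha>\<^sub>5 = 0\<close>. Replacing
  \<open>(p, t)\<close> by \<open>(p - t, -t)\<close> exchanges them, and with them the two parameters.
\<close>

lemma solves_flip: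
  assumes sol: "solves \<alpha> U x y z w q p"
  shows "solves (\<lambda>i. \<alpha> ((id(4 := 5, 5 := 4)) i)) ((*) (- 1) ` U)
    (\<lambda>\<tau>. x (- 1 * \<tau>))
    (\<lambda>\<tau>. y (- 1 * \<tau>))
    (\<lambda>\<tau>. z (- 1 * \<tau>))
    (\<lambda>\<tau>. w (- 1 * \<tau>))
    (\<lambda>\<tau>. q (- 1 * \<tau>))
    (\<lambda>\<tau>. p (- 1 * \<tau>) - (- 1 * \<tau>))"
proof (rule solves_rescaledI, goal_cases)
  case 2 show ?case
    using sol unfolding solves_def admissible_parameters_def by (simp add: algebra_simps)
next
  case (5 t) note D = solves_timeD [OF sol 5]
  show ?case
    by (rule DERIV_cong [OF D(3)])
      (use D(1) in \<open>simp add: D(2) reflection_coeff_def field_simps power2_eq_square\<close>)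
next
  case (6 t) note D = solves_timeD [OF sol 6]
  show ?case
    by (rule DERIV_cong [OF D(4)])
      (use D(1) in \<open>simp add: D(2) reflection_coeff_def field_simps power2_eq_square\<close>)
next
  case (7 t) note D = solves_timeD [OF sol 7]
  show ?case
    by (rule DERIV_cong [OF D(5)])
      (use D(1) in \<open>simp add: D(2) reflection_coeff_def field_simps power2_eq_square\<close>)
next
  case (8 t) note D = solves_timeD [OF sol 8]
  show ?case
    by (rule DERIV_cong [OF D(6)])
      (use D(1) in \<open>simp add: D(2) reflection_coeff_def field_simps power2_eq_square\<close>)
next
  case (9 t) note D = solves_timeD [OF sol 9]
  show ?case
    by (rule DERIV_cong [OF D(7)])
      (use D(1) in \<open>simp add: D(2) reflection_coeff_def field_simps power2_eq_square\<close>)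
next
  case (10 t) note D = solves_timeD [OF sol 10]
  show ?case
    by (rule DERIV_cong [OF DERIV_diff [OF D(8) DERIV_ident]])
      (use D(1) in \<open>simp add: D(2) reflection_coeff_def field_simps power2_eq_square\<close>)
qed (use sol in \<open>simp_all add: solves_iff\<close>)

section \<open>The generators as birational transformations\<close>

lemma indet_nonzero: "indet v \<noteq> 0"
  by (rule nonzero_if_value_nonzero [OF has_value_indet, of "\<lambda>_. 1"]) simp

lemma indet_diff_nonzero: "u \<noteq> v \<Longrightarrow> indet u - indet v \<noteq> 0"
  by (rule nonzero_if_value_nonzero [OF has_value_diff [OF has_value_indet has_value_indet],
        of "(\<lambda>_. 0)(u := 1)"]) simp

lemma indet_mult_diff_1_nonzero: "indet u * indet v - 1 \<noteq> 0"
  by (rule nonzero_if_value_nonzero [OF has_value_diff [OF has_value_mult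
        [OF has_value_indet has_value_indet] has_value_1], of "\<lambda>_. 0"]) simp

lemmas denominators_nonzero [simp] = indet_nonzero
  indet_diff_nonzero [of VX VZ, simplified] indet_diff_nonzero [of VP VT, simplified]
  indet_mult_diff_1_nonzero [of VZ VQ, simplified]

definition mA5 :: mpoly where
  "mA5 = 1 - 2 * mvar VA0 - 2 * mvar VA1 - 2 * mvar VA2 - 2 * mvar VA3 - mvar VA4"

definition image_of :: "ratfun list \<Rightarrow> var \<Rightarrow> ratfun" where
  "image_of fs v = fs ! var_index v"

text \<open>
  The tables \<open>ks\<close> and \<open>gs\<close> list, in the order of \<open>var_index\<close>, the exponent of \<open>h\<close> that clears the
  denominator of each image and the resulting numerator.
\<close>

lemma ratfun_involution_image_of:
  assumes "emb h \<noteq> 0" "subst (image_of fs) h \<noteq> 0"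
    and "\<And>v. emb h ^ (ks ! var_index v) * image_of fs v = emb (gs ! var_index v)"
    and "\<And>v. subst (image_of fs) (gs ! var_index v) =
               subst (image_of fs) h ^ (ks ! var_index v) * indet v"
  shows "ratfun_involution (extend (image_of fs))"
    and "extend (image_of fs) (indet v) = fs ! var_index v"
proof -
  have h: "h \<noteq> 0" using assms(1) by (simp add: emb_eq_0_iff)
  have ex: "\<exists>k g. emb h ^ k * image_of fs v = emb g \<and>
      subst (image_of fs) g = subst (image_of fs) h ^ k * indet v" for v
    using assms(3,4) by blast
  note * = ratfun_involution_extend [OF h assms(2) ex]
  show "ratfun_involution (extend (image_of fs))" by (rule *)
  show "extend (image_of fs) (indet v) = fs ! var_index v"
    by (simp only: *(2) image_of_def)
qed

definition s0 :: "ratfun \<Rightarrow> ratfun" where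
  "s0 = extend (image_of
     [- X - 2 * A0 / Y - 1 / Y^2, - Y, - Z, - W, - Q, - P, - T,
      - A0, A1 + 2 * A0, A2, A3, A4])"

definition s1 :: "ratfun \<Rightarrow> ratfun" where
  "s1 = extend (image_of
     [X, Y - A1 / (X - Z), Z, W + A1 / (X - Z), Q, P, T,
      A0 + A1, - A1, A2 + A1, A3, A4])"

definition s2 :: "ratfun \<Rightarrow> ratfun" where
  "s2 = extend (image_of
     [X, Y, Z + A2 / W, W, Q, P, T,
      A0, A1 + A2, - A2, A3 + A2, A4])"

definition s3 :: "ratfun \<Rightarrow> ratfun" where
  "s3 = extend (image_of
     [X, Y, Z, W - A3 * Q / (Z * Q - 1), Q, P - A3 * Z / (Z * Q - 1), T,
      A0, A1, A2 + A3, - A3, A4 + A3])"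

definition s4 :: "ratfun \<Rightarrow> ratfun" where
  "s4 = extend (image_of
     [X, Y, Z, W, Q + A4 / P, P, T,
      A0, A1, A2, A3 + A4, - A4])"

definition s5 :: "ratfun \<Rightarrow> ratfun" where
  "s5 = extend (image_of
     [X, Y, Z, W, Q + A5 / (P - T), P, T,
      A0, A1, A2, A3 + A5, A4])"

definition flip :: "ratfun \<Rightarrow> ratfun" where
  "flip = extend (image_of
     [X, Y, Z, W, Q, P - T, - T,
      A0, A1, A2, A3, A5])"

lemma s0_involution: "ratfun_involution s0"
  and s0_images [simp]:
  "s0 X = - X - 2 * A0 / Y - 1 / Y^2" "s0 Y = - Y" "s0 Z = - Z" "s0 W = - W" "s0 Q = - Q"
  "s0 P = - P" "s0 T = - T" "s0 A0 = - A0" "s0 A1 = A1 + 2 * A0" "s0 A2 = A2" "s0 A3 = A3"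
  "s0 A4 = A4" "s0 A5 = A5"
proof -
  let ?fs = "[- X - 2 * A0 / Y - 1 / Y^2, - Y, - Z, - W, - Q, - P, - T,
       - A0, A1 + 2 * A0, A2, A3, A4]"
  let ?h = "mvar VY"
  let ?ks = "[2, 0, 0, 0, 0, 0, 0, 0, 0, 0, 0, 0] :: nat list"
  let ?gs = "[- mvar VX * mvar VY^2 - 2 * mvar VA0 * mvar VY - 1, - mvar VY, - mvar VZ, - mvar VW,
       - mvar VQ, - mvar VP, - mvar VT, - mvar VA0, mvar VA1 + 2 * mvar VA0, mvar VA2, mvar VA3,
       mvar VA4]"
  have 1: "emb ?h \<noteq> 0" "subst (image_of ?fs) ?h \<noteq> 0"
    by (simp_all add: emb_simps emb_numeral emb_power subst.peval_simps image_of_def)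
  have 2: "emb ?h ^ (?ks ! var_index v) * image_of ?fs v = emb (?gs ! var_index v)" for v
    by (cases v) (simp_all add: emb_simps emb_numeral emb_power image_of_def A5_def mA5_def divide_simps,
       (simp add: algebra_simps power2_eq_square)?)
  have 3: "subst (image_of ?fs) (?gs ! var_index v) =
      subst (image_of ?fs) ?h ^ (?ks ! var_index v) * indet v" for v
    by (cases v) (simp_all add: subst.peval_simps image_of_def A5_def mA5_def divide_simps,
       (simp add: algebra_simps power2_eq_square)?)
  note * = ratfun_involution_image_of [of ?h ?fs, OF 1 2 3, folded s0_def]
  show inv: "ratfun_involution s0" by (rule *)
  interpret ratfun_involution s0 by (rule inv)
  note images = *(2) [of VX] *(2) [of VY] *(2) [of VZ] *(2) [of VW] *(2) [of VQ] *(2) [of VP]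
    *(2) [of VT] *(2) [of VA0] *(2) [of VA1] *(2) [of VA2] *(2) [of VA3] *(2) [of VA4]
  show "s0 X = - X - 2 * A0 / Y - 1 / Y^2" "s0 Y = - Y" "s0 Z = - Z" "s0 W = - W" "s0 Q = - Q"
    "s0 P = - P" "s0 T = - T" "s0 A0 = - A0" "s0 A1 = A1 + 2 * A0" "s0 A2 = A2" "s0 A3 = A3"
    "s0 A4 = A4" "s0 A5 = A5"
    by (simp_all add: images A5_def)
qed

interpretation s0: ratfun_involution s0
  by (rule s0_involution)

lemma s1_involution: "ratfun_involution s1"
  and s1_images [simp]:
  "s1 X = X" "s1 Y = Y - A1 / (X - Z)" "s1 Z = Z" "s1 W = W + A1 / (X - Z)" "s1 Q = Q"
  "s1 P = P" "s1 T = T" "s1 A0 = A0 + A1" "s1 A1 = - A1" "s1 A2 = A2 + A1" "s1 A3 = A3"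
  "s1 A4 = A4" "s1 A5 = A5"
proof -
  let ?fs = "[X, Y - A1 / (X - Z), Z, W + A1 / (X - Z), Q, P, T,
       A0 + A1, - A1, A2 + A1, A3, A4]"
  let ?h = "mvar VX - mvar VZ"
  let ?ks = "[0, 1, 0, 1, 0, 0, 0, 0, 0, 0, 0, 0] :: nat list"
  let ?gs = "[mvar VX, mvar VY * (mvar VX - mvar VZ) - mvar VA1, mvar VZ,
       mvar VW * (mvar VX - mvar VZ) + mvar VA1, mvar VQ, mvar VP, mvar VT, mvar VA0 + mvar VA1,
       - mvar VA1, mvar VA2 + mvar VA1, mvar VA3, mvar VA4]"
  have 1: "emb ?h \<noteq> 0" "subst (image_of ?fs) ?h \<noteq> 0"
    by (simp_all add: emb_simps emb_numeral emb_power subst.peval_simps image_of_def)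
  have 2: "emb ?h ^ (?ks ! var_index v) * image_of ?fs v = emb (?gs ! var_index v)" for v
    by (cases v) (simp_all add: emb_simps emb_numeral emb_power image_of_def A5_def mA5_def divide_simps,
       (simp add: algebra_simps power2_eq_square)?)
  have 3: "subst (image_of ?fs) (?gs ! var_index v) =
      subst (image_of ?fs) ?h ^ (?ks ! var_index v) * indet v" for v
    by (cases v) (simp_all add: subst.peval_simps image_of_def A5_def mA5_def divide_simps,
       (simp add: algebra_simps power2_eq_square)?)
  note * = ratfun_involution_image_of [of ?h ?fs, OF 1 2 3, folded s1_def]
  show inv: "ratfun_involution s1" by (rule *)
  interpret ratfun_involution s1 by (rule inv)
  note images = *(2) [of VX] *(2) [of VY] *(2) [of VZ] *(2) [of VW] *(2) [of VQ] *(2) [of VP]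
    *(2) [of VT] *(2) [of VA0] *(2) [of VA1] *(2) [of VA2] *(2) [of VA3] *(2) [of VA4]
  show "s1 X = X" "s1 Y = Y - A1 / (X - Z)" "s1 Z = Z" "s1 W = W + A1 / (X - Z)" "s1 Q = Q"
    "s1 P = P" "s1 T = T" "s1 A0 = A0 + A1" "s1 A1 = - A1" "s1 A2 = A2 + A1" "s1 A3 = A3"
    "s1 A4 = A4" "s1 A5 = A5"
    by (simp_all add: images A5_def)
qed

interpretation s1: ratfun_involution s1
  by (rule s1_involution)

lemma s2_involution: "ratfun_involution s2"
  and s2_images [simp]:
  "s2 X = X" "s2 Y = Y" "s2 Z = Z + A2 / W" "s2 W = W" "s2 Q = Q" "s2 P = P" "s2 T = T"
  "s2 A0 = A0" "s2 A1 = A1 + A2" "s2 A2 = - A2" "s2 A3 = A3 + A2" "s2 A4 = A4" "s2 A5 = A5"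
proof -
  let ?fs = "[X, Y, Z + A2 / W, W, Q, P, T,
       A0, A1 + A2, - A2, A3 + A2, A4]"
  let ?h = "mvar VW"
  let ?ks = "[0, 0, 1, 0, 0, 0, 0, 0, 0, 0, 0, 0] :: nat list"
  let ?gs = "[mvar VX, mvar VY, mvar VZ * mvar VW + mvar VA2, mvar VW, mvar VQ, mvar VP, mvar VT, mvar VA0,
       mvar VA1 + mvar VA2, - mvar VA2, mvar VA3 + mvar VA2, mvar VA4]"
  have 1: "emb ?h \<noteq> 0" "subst (image_of ?fs) ?h \<noteq> 0"
    by (simp_all add: emb_simps emb_numeral emb_power subst.peval_simps image_of_def)
  have 2: "emb ?h ^ (?ks ! var_index v) * image_of ?fs v = emb (?gs ! var_index v)" for v
    by (cases v) (simp_all add: emb_simps emb_numeral emb_power image_of_def A5_def mA5_def divide_simps,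
       (simp add: algebra_simps power2_eq_square)?)
  have 3: "subst (image_of ?fs) (?gs ! var_index v) =
      subst (image_of ?fs) ?h ^ (?ks ! var_index v) * indet v" for v
    by (cases v) (simp_all add: subst.peval_simps image_of_def A5_def mA5_def divide_simps,
       (simp add: algebra_simps power2_eq_square)?)
  note * = ratfun_involution_image_of [of ?h ?fs, OF 1 2 3, folded s2_def]
  show inv: "ratfun_involution s2" by (rule *)
  interpret ratfun_involution s2 by (rule inv)
  note images = *(2) [of VX] *(2) [of VY] *(2) [of VZ] *(2) [of VW] *(2) [of VQ] *(2) [of VP]
    *(2) [of VT] *(2) [of VA0] *(2) [of VA1] *(2) [of VA2] *(2) [of VA3] *(2) [of VA4]
  show "s2 X = X" "s2 Y = Y" "s2 Z = Z + A2 / W" "s2 W = W" "s2 Q = Q" "s2 P = P" "s2 T = T"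
    "s2 A0 = A0" "s2 A1 = A1 + A2" "s2 A2 = - A2" "s2 A3 = A3 + A2" "s2 A4 = A4" "s2 A5 = A5"
    by (simp_all add: images A5_def)
qed

interpretation s2: ratfun_involution s2
  by (rule s2_involution)

lemma s3_involution: "ratfun_involution s3"
  and s3_images [simp]:
  "s3 X = X" "s3 Y = Y" "s3 Z = Z" "s3 W = W - A3 * Q / (Z * Q - 1)" "s3 Q = Q"
  "s3 P = P - A3 * Z / (Z * Q - 1)" "s3 T = T" "s3 A0 = A0" "s3 A1 = A1" "s3 A2 = A2 + A3"
  "s3 A3 = - A3" "s3 A4 = A4 + A3" "s3 A5 = A5 + A3"
proof -
  let ?fs = "[X, Y, Z, W - A3 * Q / (Z * Q - 1), Q, P - A3 * Z / (Z * Q - 1), T,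
       A0, A1, A2 + A3, - A3, A4 + A3]"
  let ?h = "mvar VZ * mvar VQ - 1"
  let ?ks = "[0, 0, 0, 1, 0, 1, 0, 0, 0, 0, 0, 0] :: nat list"
  let ?gs = "[mvar VX, mvar VY, mvar VZ, mvar VW * (mvar VZ * mvar VQ - 1) - mvar VA3 * mvar VQ, mvar VQ,
       mvar VP * (mvar VZ * mvar VQ - 1) - mvar VA3 * mvar VZ, mvar VT, mvar VA0, mvar VA1,
       mvar VA2 + mvar VA3, - mvar VA3, mvar VA4 + mvar VA3]"
  have 1: "emb ?h \<noteq> 0" "subst (image_of ?fs) ?h \<noteq> 0"
    by (simp_all add: emb_simps emb_numeral emb_power subst.peval_simps image_of_def)
  have 2: "emb ?h ^ (?ks ! var_index v) * image_of ?fs v = emb (?gs ! var_index v)" for v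
    by (cases v) (simp_all add: emb_simps emb_numeral emb_power image_of_def A5_def mA5_def divide_simps,
       (simp add: algebra_simps power2_eq_square)?)
  have 3: "subst (image_of ?fs) (?gs ! var_index v) =
      subst (image_of ?fs) ?h ^ (?ks ! var_index v) * indet v" for v
    by (cases v) (simp_all add: subst.peval_simps image_of_def A5_def mA5_def divide_simps,
       (simp add: algebra_simps power2_eq_square)?)
  note * = ratfun_involution_image_of [of ?h ?fs, OF 1 2 3, folded s3_def]
  show inv: "ratfun_involution s3" by (rule *)
  interpret ratfun_involution s3 by (rule inv)
  note images = *(2) [of VX] *(2) [of VY] *(2) [of VZ] *(2) [of VW] *(2) [of VQ] *(2) [of VP]
    *(2) [of VT] *(2) [of VA0] *(2) [of VA1] *(2) [of VA2] *(2) [of VA3] *(2) [of VA4]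
  show "s3 X = X" "s3 Y = Y" "s3 Z = Z" "s3 W = W - A3 * Q / (Z * Q - 1)" "s3 Q = Q"
    "s3 P = P - A3 * Z / (Z * Q - 1)" "s3 T = T" "s3 A0 = A0" "s3 A1 = A1" "s3 A2 = A2 + A3"
    "s3 A3 = - A3" "s3 A4 = A4 + A3" "s3 A5 = A5 + A3"
    by (simp_all add: images A5_def)
qed

interpretation s3: ratfun_involution s3
  by (rule s3_involution)

lemma s4_involution: "ratfun_involution s4"
  and s4_images [simp]:
  "s4 X = X" "s4 Y = Y" "s4 Z = Z" "s4 W = W" "s4 Q = Q + A4 / P" "s4 P = P" "s4 T = T"
  "s4 A0 = A0" "s4 A1 = A1" "s4 A2 = A2" "s4 A3 = A3 + A4" "s4 A4 = - A4" "s4 A5 = A5"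
proof -
  let ?fs = "[X, Y, Z, W, Q + A4 / P, P, T,
       A0, A1, A2, A3 + A4, - A4]"
  let ?h = "mvar VP"
  let ?ks = "[0, 0, 0, 0, 1, 0, 0, 0, 0, 0, 0, 0] :: nat list"
  let ?gs = "[mvar VX, mvar VY, mvar VZ, mvar VW, mvar VQ * mvar VP + mvar VA4, mvar VP, mvar VT, mvar VA0,
       mvar VA1, mvar VA2, mvar VA3 + mvar VA4, - mvar VA4]"
  have 1: "emb ?h \<noteq> 0" "subst (image_of ?fs) ?h \<noteq> 0"
    by (simp_all add: emb_simps emb_numeral emb_power subst.peval_simps image_of_def)
  have 2: "emb ?h ^ (?ks ! var_index v) * image_of ?fs v = emb (?gs ! var_index v)" for v
    by (cases v) (simp_all add: emb_simps emb_numeral emb_power image_of_def A5_def mA5_def divide_simps,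
       (simp add: algebra_simps power2_eq_square)?)
  have 3: "subst (image_of ?fs) (?gs ! var_index v) =
      subst (image_of ?fs) ?h ^ (?ks ! var_index v) * indet v" for v
    by (cases v) (simp_all add: subst.peval_simps image_of_def A5_def mA5_def divide_simps,
       (simp add: algebra_simps power2_eq_square)?)
  note * = ratfun_involution_image_of [of ?h ?fs, OF 1 2 3, folded s4_def]
  show inv: "ratfun_involution s4" by (rule *)
  interpret ratfun_involution s4 by (rule inv)
  note images = *(2) [of VX] *(2) [of VY] *(2) [of VZ] *(2) [of VW] *(2) [of VQ] *(2) [of VP]
    *(2) [of VT] *(2) [of VA0] *(2) [of VA1] *(2) [of VA2] *(2) [of VA3] *(2) [of VA4]
  show "s4 X = X" "s4 Y = Y" "s4 Z = Z" "s4 W = W" "s4 Q = Q + A4 / P" "s4 P = P" "s4 T = T"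
    "s4 A0 = A0" "s4 A1 = A1" "s4 A2 = A2" "s4 A3 = A3 + A4" "s4 A4 = - A4" "s4 A5 = A5"
    by (simp_all add: images A5_def)
qed

interpretation s4: ratfun_involution s4
  by (rule s4_involution)

lemma s5_involution: "ratfun_involution s5"
  and s5_images [simp]:
  "s5 X = X" "s5 Y = Y" "s5 Z = Z" "s5 W = W" "s5 Q = Q + A5 / (P - T)" "s5 P = P" "s5 T = T"
  "s5 A0 = A0" "s5 A1 = A1" "s5 A2 = A2" "s5 A3 = A3 + A5" "s5 A4 = A4" "s5 A5 = - A5"
proof -
  let ?fs = "[X, Y, Z, W, Q + A5 / (P - T), P, T,
       A0, A1, A2, A3 + A5, A4]"
  let ?h = "mvar VP - mvar VT"
  let ?ks = "[0, 0, 0, 0, 1, 0, 0, 0, 0, 0, 0, 0] :: nat list"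
  let ?gs = "[mvar VX, mvar VY, mvar VZ, mvar VW, mvar VQ * (mvar VP - mvar VT) + mA5, mvar VP, mvar VT,
       mvar VA0, mvar VA1, mvar VA2, mvar VA3 + mA5, mvar VA4]"
  have 1: "emb ?h \<noteq> 0" "subst (image_of ?fs) ?h \<noteq> 0"
    by (simp_all add: emb_simps emb_numeral emb_power subst.peval_simps image_of_def)
  have 2: "emb ?h ^ (?ks ! var_index v) * image_of ?fs v = emb (?gs ! var_index v)" for v
    by (cases v) (simp_all add: emb_simps emb_numeral emb_power image_of_def A5_def mA5_def divide_simps,
       (simp add: algebra_simps power2_eq_square)?)
  have 3: "subst (image_of ?fs) (?gs ! var_index v) =
      subst (image_of ?fs) ?h ^ (?ks ! var_index v) * indet v" for v
    by (cases v) (simp_all add: subst.peval_simps image_of_def A5_def mA5_def divide_simps,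
       (simp add: algebra_simps power2_eq_square)?)
  note * = ratfun_involution_image_of [of ?h ?fs, OF 1 2 3, folded s5_def]
  show inv: "ratfun_involution s5" by (rule *)
  interpret ratfun_involution s5 by (rule inv)
  note images = *(2) [of VX] *(2) [of VY] *(2) [of VZ] *(2) [of VW] *(2) [of VQ] *(2) [of VP]
    *(2) [of VT] *(2) [of VA0] *(2) [of VA1] *(2) [of VA2] *(2) [of VA3] *(2) [of VA4]
  show "s5 X = X" "s5 Y = Y" "s5 Z = Z" "s5 W = W" "s5 Q = Q + A5 / (P - T)" "s5 P = P" "s5 T = T"
    "s5 A0 = A0" "s5 A1 = A1" "s5 A2 = A2" "s5 A3 = A3 + A5" "s5 A4 = A4" "s5 A5 = - A5"
    by (simp_all add: images A5_def)
qed

interpretation s5: ratfun_involution s5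
  by (rule s5_involution)

lemma flip_involution: "ratfun_involution flip"
  and flip_images [simp]:
  "flip X = X" "flip Y = Y" "flip Z = Z" "flip W = W" "flip Q = Q" "flip P = P - T"
  "flip T = - T" "flip A0 = A0" "flip A1 = A1" "flip A2 = A2" "flip A3 = A3" "flip A4 = A5"
  "flip A5 = A4"
proof -
  let ?fs = "[X, Y, Z, W, Q, P - T, - T,
       A0, A1, A2, A3, A5]"
  let ?h = "1"
  let ?ks = "[0, 0, 0, 0, 0, 0, 0, 0, 0, 0, 0, 0] :: nat list"
  let ?gs = "[mvar VX, mvar VY, mvar VZ, mvar VW, mvar VQ, mvar VP - mvar VT, - mvar VT, mvar VA0,
       mvar VA1, mvar VA2, mvar VA3, mA5]"
  have 1: "emb ?h \<noteq> 0" "subst (image_of ?fs) ?h \<noteq> 0"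
    by (simp_all add: emb_simps emb_numeral emb_power subst.peval_simps image_of_def)
  have 2: "emb ?h ^ (?ks ! var_index v) * image_of ?fs v = emb (?gs ! var_index v)" for v
    by (cases v) (simp_all add: emb_simps emb_numeral emb_power image_of_def A5_def mA5_def divide_simps,
       (simp add: algebra_simps power2_eq_square)?)
  have 3: "subst (image_of ?fs) (?gs ! var_index v) =
      subst (image_of ?fs) ?h ^ (?ks ! var_index v) * indet v" for v
    by (cases v) (simp_all add: subst.peval_simps image_of_def A5_def mA5_def divide_simps,
       (simp add: algebra_simps power2_eq_square)?)
  note * = ratfun_involution_image_of [of ?h ?fs, OF 1 2 3, folded flip_def]
  show inv: "ratfun_involution flip" by (rule *)
  interpret ratfun_involution flip by (rule inv)
  note images = *(2) [of VX] *(2) [of VY] *(2) [of VZ] *(2) [of VW] *(2) [of VQ] *(2) [of VP]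
    *(2) [of VT] *(2) [of VA0] *(2) [of VA1] *(2) [of VA2] *(2) [of VA3] *(2) [of VA4]
  show "flip X = X" "flip Y = Y" "flip Z = Z" "flip W = W" "flip Q = Q" "flip P = P - T"
    "flip T = - T" "flip A0 = A0" "flip A1 = A1" "flip A2 = A2" "flip A3 = A3" "flip A4 = A5"
    "flip A5 = A4"
    by (simp_all add: images A5_def)
qed

interpretation flip: ratfun_involution flip
  by (rule flip_involution)

section \<open>Relations between the generators\<close>

text \<open>
  The direct expansion of these words is large. Instead, with the notation of the proof, \<open>s0\<close> and
  \<open>s1\<close> act on a few polynomials by monomial substitutions: \<open>v\<close> and \<open>e\<close> are the numerators that arise
  from \<open>u\<close> and \<open>d'\<close>; \<open>s1\<close> fixes \<open>v\<close>, and \<open>s0\<close> fixes \<open>e\<close>. So all images of \<open>X\<close> and \<open>Y\<close> stay short fractions in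
  these polynomials. The image of \<open>W\<close> follows from that of \<open>Y\<close> because \<open>s1\<close> fixes \<open>Y + W\<close> and \<open>s0\<close> only
  changes its sign.
\<close>

lemma braid_s0_s1: "s0 \<circ> s1 \<circ> s0 \<circ> s1 = s1 \<circ> s0 \<circ> s1 \<circ> s0"
proof (rule ratfun_hom_eqI)
  \<comment> \<open>Up to powers of \<open>Y\<close> and signs, \<open>d'\<close> is \<open>s0 d\<close> and \<open>v\<close> is \<open>s0 u\<close>; up to powers of \<open>d\<close>, \<open>u\<close> is \<open>s1 Y\<close> and
        \<open>e\<close> is \<open>s1 d'\<close>.\<close>
  define d where "d = X - Z"
  define d' where "d' = d * Y^2 + 2 * A0 * Y + 1"
  define u where "u = Y * d - A1"
  define v where "v = u * Y + 1"
  define e where "e = u^2 + 2 * (A0 + A1) * u + d"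
  have s0: "s0 d = - d' / Y^2" "s0 u = v / Y" "s0 v = - u * Y"
    by (simp_all add: d_def d'_def u_def v_def divide_simps; simp add: algebra_simps power2_eq_square)+
  have s0e: "s0 e = e"
    unfolding e_def
    by (simp add: s0) (simp add: d'_def u_def v_def d_def divide_simps; simp add: algebra_simps power2_eq_square)
  have d: "d \<noteq> 0" by (simp add: d_def)
  have s1: "s1 d = d" by (simp add: d_def)
  have s1Y: "s1 Y = u / d" using d by (simp add: u_def divide_simps; simp add: d_def)
  have s1u: "s1 u = Y * d" using d unfolding u_def by (simp add: s1 s1Y del: s1_images(2)) (simp add: u_def)
  have s1v: "s1 v = v" using d unfolding v_def by (simp add: s1u s1Y del: s1_images(2))
  have s1d': "s1 d' = e / d" using d unfolding d'_def e_def
    by (simp add: s1 s1Y divide_simps del: s1_images(2); simp add: algebra_simps power2_eq_square)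
  have s1e: "s1 e = d * d'" using d unfolding d'_def e_def
    by (simp add: s1 s1u divide_simps del: s1_images(2); simp add: u_def algebra_simps power2_eq_square)
  have u: "u \<noteq> 0" using d s1u by auto
  have v: "v \<noteq> 0" using u s0(2) by auto
  have d': "d' \<noteq> 0"
    using d s0(1) by (metis divide_eq_0_iff neg_equal_0_iff_equal s0.hom_eq_0_iff)
  have e: "e \<noteq> 0"
    using d' s1d' by (metis divide_eq_0_iff s1.hom_eq_0_iff)
  have s0s1Y: "s0 (s1 Y) = - v * Y / d'"
    using d' by (simp add: s1Y s0 divide_simps power2_eq_square del: s1_images(2))
  have s1s0s1Y: "s1 (s0 (s1 Y)) = - u * v / e"
    using d e unfolding s0s1Y by (simp add: s1Y s1v s1d' del: s1_images(2))
  have s0s1s0s1Y: "s0 (s1 (s0 (s1 Y))) = u * v / e"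
    unfolding s1s0s1Y by (simp add: s0 s0e)
  have "s1 (s0 (s1 (s0 Y))) = - s1 (s0 (s1 Y))"
    by (simp only: s0_images s0.hom_uminus s1.hom_uminus)
  also have "\<dots> = u * v / e"
    unfolding s1s0s1Y by simp
  finally have Y: "s0 (s1 (s0 (s1 Y))) = s1 (s0 (s1 (s0 Y)))"
    using s0s1s0s1Y by metis
  have "s1 (s0 X) = - X - 2 * (A0 + A1) / s1 Y - 1 / (s1 Y)^2"
    by simp
  also have "\<dots> = - Z - d * e / u^2"
    using d u unfolding s1Y by (simp add: divide_simps) (simp add: e_def d_def algebra_simps power2_eq_square)
  finally have s1s0X: "s1 (s0 X) = - Z - d * e / u^2" .
  have s0s1s0X: "s0 (s1 (s0 X)) = Z + d' * e / v^2"
    using u v unfolding s1s0X by (simp add: s0 s0e divide_simps)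
  have "s1 (Z + d' * e / v^2) = Z + d' * e / v^2"
    using d v by (simp add: s1d' s1e s1v)
  then have X: "s0 (s1 (s0 (s1 X))) = s1 (s0 (s1 (s0 X)))"
    unfolding s1_images(1) s0s1s0X by (rule sym)
  have s1W: "s1 W = W + Y - s1 Y" by simp
  have "s0 (s1 (s0 (s1 W))) = W + Y - s0 (s1 (s0 (s1 Y)))"
    unfolding s1W s0.hom_add s0.hom_diff s1.hom_add s1.hom_diff s0_images s1.hom_uminus s0.hom_uminus
    by (simp add: algebra_simps)
  moreover have "s1 (s0 (s1 (s0 W))) = W + Y - s1 (s0 (s1 (s0 Y)))"
    unfolding s0_images s1W s0.hom_add s0.hom_diff s1.hom_add s1.hom_diff s1.hom_uminus s0.hom_uminus
    by (simp add: algebra_simps)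
  ultimately have W: "s0 (s1 (s0 (s1 W))) = s1 (s0 (s1 (s0 W)))" using Y by (simp only:)
  show "(s0 \<circ> s1 \<circ> s0 \<circ> s1) (indet r) = (s1 \<circ> s0 \<circ> s1 \<circ> s0) (indet r)" for r
  proof (cases r)
    case VX then show ?thesis using X by (simp only: o_apply)
  next
    case VY then show ?thesis using Y by (simp only: o_apply)
  next
    case VW then show ?thesis using W by (simp only: o_apply)
  qed (simp_all add: algebra_simps)
qed (intro ratfun_hom_compose s0.ratfun_hom_axioms s1.ratfun_hom_axioms)+

text \<open>
  In the following pairs the fractions are small enough to be compared directly. Clearing
  denominators requires them to be nonzero in the expanded form in which they occur, which is
  obtained by applying the automorphisms to the nonzero denominators of the generators.
\<close>

lemma commute_s0_s2: "s0 \<circ> s2 = s2 \<circ> s0"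
proof (rule ratfun_hom_eqI)
  have "s2 Y \<noteq> 0"
    "s0 W \<noteq> 0"
    unfolding s0.hom_eq_0_iff s2.hom_eq_0_iff by simp_all
  then show "(s0 \<circ> s2) (indet v) = (s2 \<circ> s0) (indet v)" for v
    by (cases v; simp add: divide_simps; simp add: algebra_simps power2_eq_square)
qed (intro ratfun_hom_compose s0.ratfun_hom_axioms s2.ratfun_hom_axioms)+

lemma commute_s0_s3: "s0 \<circ> s3 = s3 \<circ> s0"
proof (rule ratfun_hom_eqI)
  have "s3 Y \<noteq> 0"
    "s0 (Z * Q - 1) \<noteq> 0"
    unfolding s0.hom_eq_0_iff s3.hom_eq_0_iff by simp_all
  then show "(s0 \<circ> s3) (indet v) = (s3 \<circ> s0) (indet v)" for v
    by (cases v; simp add: divide_simps; simp add: algebra_simps power2_eq_square)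
qed (intro ratfun_hom_compose s0.ratfun_hom_axioms s3.ratfun_hom_axioms)+

lemma commute_s0_s4: "s0 \<circ> s4 = s4 \<circ> s0"
proof (rule ratfun_hom_eqI)
  have "s4 Y \<noteq> 0"
    "s0 P \<noteq> 0"
    unfolding s0.hom_eq_0_iff s4.hom_eq_0_iff by simp_all
  then show "(s0 \<circ> s4) (indet v) = (s4 \<circ> s0) (indet v)" for v
    by (cases v; simp add: divide_simps; simp add: algebra_simps power2_eq_square)
qed (intro ratfun_hom_compose s0.ratfun_hom_axioms s4.ratfun_hom_axioms)+

lemma commute_s0_s5: "s0 \<circ> s5 = s5 \<circ> s0"
proof (rule ratfun_hom_eqI)
  have "s5 Y \<noteq> 0"
    "s0 (P - T) \<noteq> 0"
    unfolding s0.hom_eq_0_iff s5.hom_eq_0_iff by simp_all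
  then show "(s0 \<circ> s5) (indet v) = (s5 \<circ> s0) (indet v)" for v
    by (cases v; simp add: divide_simps; simp add: algebra_simps power2_eq_square)
qed (intro ratfun_hom_compose s0.ratfun_hom_axioms s5.ratfun_hom_axioms)+

lemma braid_s1_s2: "s1 \<circ> s2 \<circ> s1 = s2 \<circ> s1 \<circ> s2"
proof (rule ratfun_hom_eqI)
  have "s2 (X - Z) \<noteq> 0"
    "s1 (s2 (X - Z)) \<noteq> 0"
    "s1 W \<noteq> 0"
    "s2 (s1 W) \<noteq> 0"
    unfolding s1.hom_eq_0_iff s2.hom_eq_0_iff by simp_all
  then show "(s1 \<circ> s2 \<circ> s1) (indet v) = (s2 \<circ> s1 \<circ> s2) (indet v)" for v
    by (cases v; simp add: divide_simps; simp add: algebra_simps power2_eq_square)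
qed (intro ratfun_hom_compose s1.ratfun_hom_axioms s2.ratfun_hom_axioms)+

lemma commute_s1_s3: "s1 \<circ> s3 = s3 \<circ> s1"
proof (rule ratfun_hom_eqI)
  show "(s1 \<circ> s3) (indet v) = (s3 \<circ> s1) (indet v)" for v
    by (cases v; simp add: divide_simps; simp add: algebra_simps power2_eq_square)
qed (intro ratfun_hom_compose s1.ratfun_hom_axioms s3.ratfun_hom_axioms)+

lemma commute_s1_s4: "s1 \<circ> s4 = s4 \<circ> s1"
proof (rule ratfun_hom_eqI)
  show "(s1 \<circ> s4) (indet v) = (s4 \<circ> s1) (indet v)" for v
    by (cases v; simp add: divide_simps; simp add: algebra_simps power2_eq_square)
qed (intro ratfun_hom_compose s1.ratfun_hom_axioms s4.ratfun_hom_axioms)+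

lemma commute_s1_s5: "s1 \<circ> s5 = s5 \<circ> s1"
proof (rule ratfun_hom_eqI)
  show "(s1 \<circ> s5) (indet v) = (s5 \<circ> s1) (indet v)" for v
    by (cases v; simp add: divide_simps; simp add: algebra_simps power2_eq_square)
qed (intro ratfun_hom_compose s1.ratfun_hom_axioms s5.ratfun_hom_axioms)+

lemma braid_s2_s3: "s2 \<circ> s3 \<circ> s2 = s3 \<circ> s2 \<circ> s3"
proof (rule ratfun_hom_eqI)
  have "s3 W \<noteq> 0"
    "s2 (s3 W) \<noteq> 0"
    "s2 (Z * Q - 1) \<noteq> 0"
    "s3 (s2 (Z * Q - 1)) \<noteq> 0"
    unfolding s2.hom_eq_0_iff s3.hom_eq_0_iff by simp_all
  then show "(s2 \<circ> s3 \<circ> s2) (indet v) = (s3 \<circ> s2 \<circ> s3) (indet v)" for v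
    by (cases v; simp add: divide_simps; simp add: algebra_simps power2_eq_square)
qed (intro ratfun_hom_compose s2.ratfun_hom_axioms s3.ratfun_hom_axioms)+

lemma commute_s2_s4: "s2 \<circ> s4 = s4 \<circ> s2"
proof (rule ratfun_hom_eqI)
  show "(s2 \<circ> s4) (indet v) = (s4 \<circ> s2) (indet v)" for v
    by (cases v; simp add: divide_simps; simp add: algebra_simps power2_eq_square)
qed (intro ratfun_hom_compose s2.ratfun_hom_axioms s4.ratfun_hom_axioms)+

lemma commute_s2_s5: "s2 \<circ> s5 = s5 \<circ> s2"
proof (rule ratfun_hom_eqI)
  show "(s2 \<circ> s5) (indet v) = (s5 \<circ> s2) (indet v)" for v
    by (cases v; simp add: divide_simps; simp add: algebra_simps power2_eq_square)
qed (intro ratfun_hom_compose s2.ratfun_hom_axioms s5.ratfun_hom_axioms)+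

lemma braid_s3_s4: "s3 \<circ> s4 \<circ> s3 = s4 \<circ> s3 \<circ> s4"
proof (rule ratfun_hom_eqI)
  have "s4 (Z * Q - 1) \<noteq> 0"
    "s3 (s4 (Z * Q - 1)) \<noteq> 0"
    "s3 P \<noteq> 0"
    "s4 (s3 P) \<noteq> 0"
    unfolding s3.hom_eq_0_iff s4.hom_eq_0_iff by simp_all
  then show "(s3 \<circ> s4 \<circ> s3) (indet v) = (s4 \<circ> s3 \<circ> s4) (indet v)" for v
    by (cases v; simp add: divide_simps; simp add: algebra_simps power2_eq_square)
qed (intro ratfun_hom_compose s3.ratfun_hom_axioms s4.ratfun_hom_axioms)+

lemma commute_s4_s5: "s4 \<circ> s5 = s5 \<circ> s4"
proof (rule ratfun_hom_eqI)
  show "(s4 \<circ> s5) (indet v) = (s5 \<circ> s4) (indet v)" for v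
    by (cases v; simp add: divide_simps; simp add: algebra_simps power2_eq_square)
qed (intro ratfun_hom_compose s4.ratfun_hom_axioms s5.ratfun_hom_axioms)+

lemma flip_reflection: "flip \<circ> s0 = s0 \<circ> flip"  "flip \<circ> s1 = s1 \<circ> flip"
  "flip \<circ> s2 = s2 \<circ> flip" "flip \<circ> s3 = s3 \<circ> flip"
  "flip \<circ> s4 = s5 \<circ> flip" "flip \<circ> s5 = s4 \<circ> flip"
proof -
  note homs = ratfun_hom_compose flip.ratfun_hom_axioms s0.ratfun_hom_axioms s1.ratfun_hom_axioms
    s2.ratfun_hom_axioms s3.ratfun_hom_axioms s4.ratfun_hom_axioms s5.ratfun_hom_axioms
  show "flip \<circ> s0 = s0 \<circ> flip"
  proof (rule ratfun_hom_eqI)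
    show "(flip \<circ> s0) (indet v) = (s0 \<circ> flip) (indet v)" for v
      by (cases v) simp_all
  qed (intro homs)+
  show "flip \<circ> s1 = s1 \<circ> flip"
  proof (rule ratfun_hom_eqI)
    show "(flip \<circ> s1) (indet v) = (s1 \<circ> flip) (indet v)" for v
      by (cases v) simp_all
  qed (intro homs)+
  show "flip \<circ> s2 = s2 \<circ> flip"
  proof (rule ratfun_hom_eqI)
    show "(flip \<circ> s2) (indet v) = (s2 \<circ> flip) (indet v)" for v
      by (cases v) simp_all
  qed (intro homs)+
  show "flip \<circ> s3 = s3 \<circ> flip"
  proof (rule ratfun_hom_eqI)
    show "(flip \<circ> s3) (indet v) = (s3 \<circ> flip) (indet v)" for v
      by (cases v) simp_all
  qed (intro homs)+
  show "flip \<circ> s4 = s5 \<circ> flip"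
  proof (rule ratfun_hom_eqI)
    show "(flip \<circ> s4) (indet v) = (s5 \<circ> flip) (indet v)" for v
      by (cases v) simp_all
  qed (intro homs)+
  show "flip \<circ> s5 = s4 \<circ> flip"
  proof (rule ratfun_hom_eqI)
    show "(flip \<circ> s5) (indet v) = (s4 \<circ> flip) (indet v)" for v
      by (cases v) simp_all
  qed (intro homs)+
qed

text \<open>
  The involution \<open>flip\<close> fixes \<open>s3\<close> and exchanges \<open>s4\<close> with \<open>s5\<close>, so this is a conjugate of
  \<open>braid_s3_s4\<close>.
\<close>

lemma braid_s3_s5: "s3 \<circ> s5 \<circ> s3 = s5 \<circ> s3 \<circ> s5"
proof
  fix f
  have s3: "s3 (flip g) = flip (s3 g)" and s5: "s5 (flip g) = flip (s4 g)" for g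
    using fun_cong [OF flip_reflection(4), of g] fun_cong [OF flip_reflection(5), of g]
    by (simp_all only: o_apply)
  have "s3 (s4 (s3 (flip f))) = s4 (s3 (s4 (flip f)))"
    using fun_cong [OF braid_s3_s4, of "flip f"] by (simp only: o_apply)
  then have "s3 (s5 (s3 (flip (flip f)))) = s5 (s3 (s5 (flip (flip f))))"
    by (simp only: s3 s5)
  then show "(s3 \<circ> s5 \<circ> s3) f = (s5 \<circ> s3 \<circ> s5) f"
    by (simp only: o_apply flip.hom_hom)
qed

section \<open>Baecklund transformations\<close>

lemma field_automorphism_involution:
  assumes "ratfun_involution \<phi>"
  shows "field_automorphism \<phi>"
proof -
  interpret ratfun_involution \<phi> by fact
  show ?thesis
    unfolding field_automorphism_def by (auto intro: involuntory_imp_bij)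
qed

text \<open>
  The defining condition of a Baecklund transformation speaks of values of field elements, which
  are unspecified outside their domain. Here they are replaced by explicit functions \<open>x', \<dots>, p'\<close>
  of time that have the right values along the solution.
\<close>

lemma baecklundI:
  assumes inv: "ratfun_involution \<phi>" and \<epsilon>: "\<epsilon> \<in> {1, -1}" "\<phi> T = const \<epsilon> * T"
    and A: "\<And>i. i \<le> 5 \<Longrightarrow> \<phi> (A i) = (\<Sum>j\<le>5. const (c i j) * A j)"
    and sol: "\<And>\<alpha> U x y z w q p.
      solves \<alpha> U x y z w q p \<Longrightarrow>
      \<forall>t\<in>U. \<forall>f\<in>{X, Y, Z, W, Q, P}.
        regular_at (\<phi> f) (point \<alpha> (x t) (y t) (z t) (w t) (q t) (p t) t) \<Longrightarrow>
      \<exists>x' y' z' w' q' p' \<alpha>'.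
        (\<forall>t\<in>U. list_all2 (\<lambda>f. has_value (\<phi> f) (point \<alpha> (x t) (y t) (z t) (w t) (q t) (p t) t))
          [X, Y, Z, W, Q, P] [x' t, y' t, z' t, w' t, q' t, p' t]) \<and>
        solves \<alpha>' ((*) \<epsilon> ` U) (\<lambda>\<tau>. x' (\<epsilon> * \<tau>)) (\<lambda>\<tau>. y' (\<epsilon> * \<tau>)) (\<lambda>\<tau>. z' (\<epsilon> * \<tau>))
          (\<lambda>\<tau>. w' (\<epsilon> * \<tau>)) (\<lambda>\<tau>. q' (\<epsilon> * \<tau>)) (\<lambda>\<tau>. p' (\<epsilon> * \<tau>)) \<and>
        (\<forall>i\<le>5. \<alpha>' i = (\<Sum>j\<le>5. c i j * \<alpha> j))"
  shows "baecklund \<phi>"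
  unfolding baecklund_def Let_def
proof (intro conjI bexI [of _ \<epsilon>] exI [of _ "\<lambda>_. 0"] exI [of _ c] allI impI; (elim conjE)?)
  show "field_automorphism \<phi>" by (rule field_automorphism_involution [OF inv])
  show "\<phi> T = const \<epsilon> * T" "\<epsilon> \<in> {1, -1}" by (fact \<epsilon>)+
  show "\<phi> (A i) = const 0 + (\<Sum>j\<le>5. const (c i j) * A j)" if "i \<le> 5" for i
    using A [OF that] by simp
next
  fix \<alpha> U x y z w q p
  assume s: "solves \<alpha> U x y z w q p"
    and reg: "\<forall>t\<in>U. \<forall>f\<in>{X, Y, Z, W, Q, P}.
      regular_at (\<phi> f) (point \<alpha> (x t) (y t) (z t) (w t) (q t) (p t) t)"
  obtain x' y' z' w' q' p' \<alpha>' where val: "\<And>t. t \<in> U \<Longrightarrow>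
        list_all2 (\<lambda>f. has_value (\<phi> f) (point \<alpha> (x t) (y t) (z t) (w t) (q t) (p t) t))
          [X, Y, Z, W, Q, P] [x' t, y' t, z' t, w' t, q' t, p' t]"
    and \<alpha>': "\<And>i. i \<le> 5 \<Longrightarrow> \<alpha>' i = (\<Sum>j\<le>5. c i j * \<alpha> j)"
    and s': "solves \<alpha>' ((*) \<epsilon> ` U) (\<lambda>\<tau>. x' (\<epsilon> * \<tau>)) (\<lambda>\<tau>. y' (\<epsilon> * \<tau>)) (\<lambda>\<tau>. z' (\<epsilon> * \<tau>))
          (\<lambda>\<tau>. w' (\<epsilon> * \<tau>)) (\<lambda>\<tau>. q' (\<epsilon> * \<tau>)) (\<lambda>\<tau>. p' (\<epsilon> * \<tau>))"
    using sol [OF s reg] by blast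
  let ?pt = "\<lambda>t. point \<alpha> (x t) (y t) (z t) (w t) (q t) (p t) t"
  show "solves (\<lambda>i. 0 + (\<Sum>j\<le>5. c i j * \<alpha> j)) ((*) \<epsilon> ` U)
     (\<lambda>\<tau>. value_at (\<phi> X) (?pt (\<epsilon> * \<tau>))) (\<lambda>\<tau>. value_at (\<phi> Y) (?pt (\<epsilon> * \<tau>)))
     (\<lambda>\<tau>. value_at (\<phi> Z) (?pt (\<epsilon> * \<tau>))) (\<lambda>\<tau>. value_at (\<phi> W) (?pt (\<epsilon> * \<tau>)))
     (\<lambda>\<tau>. value_at (\<phi> Q) (?pt (\<epsilon> * \<tau>))) (\<lambda>\<tau>. value_at (\<phi> P) (?pt (\<epsilon> * \<tau>)))"
  proof (rule solves_cong [OF s'])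
    show "0 + (\<Sum>j\<le>5. c i j * \<alpha> j) = \<alpha>' i" if "i \<le> 5" for i
      using \<alpha>' [OF that] by simp
  next
    fix \<tau> assume "\<tau> \<in> (*) \<epsilon> ` U"
    then have "\<epsilon> * \<tau> \<in> U" using \<epsilon>(1) by auto
    from val [OF this] show "value_at (\<phi> X) (?pt (\<epsilon> * \<tau>)) = x' (\<epsilon> * \<tau>) \<and>
        value_at (\<phi> Y) (?pt (\<epsilon> * \<tau>)) = y' (\<epsilon> * \<tau>) \<and>
        value_at (\<phi> Z) (?pt (\<epsilon> * \<tau>)) = z' (\<epsilon> * \<tau>) \<and>
        value_at (\<phi> W) (?pt (\<epsilon> * \<tau>)) = w' (\<epsilon> * \<tau>) \<and>
        value_at (\<phi> Q) (?pt (\<epsilon> * \<tau>)) = q' (\<epsilon> * \<tau>) \<and>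
        value_at (\<phi> P) (?pt (\<epsilon> * \<tau>)) = p' (\<epsilon> * \<tau>)"
      by (simp add: value_at_eq)
  qed
qed

lemma sum_reflection:
  fixes e :: "complex \<Rightarrow> 'b::comm_ring_1" and i k :: nat
  assumes "i \<le> 5" "k \<le> 5" and e: "\<And>u v. e (u + v) = e u + e v" "e 0 = 0" "e 1 = 1"
  shows "(\<Sum>j\<le>5. e ((if j = i then 1 else 0) + (if j = k then r else 0)) * a j) = a i + e r * a k"
proof -
  have "(\<Sum>j\<le>5. e ((if j = i then 1 else 0) + (if j = k then r else 0)) * a j) =
      (\<Sum>j\<le>5. (if j = i then a j else 0) + (if j = k then e r * a j else 0))"
    by (rule sum.cong) (auto simp: e distrib_right)
  then show ?thesis using assms(1,2) by (simp add: sum.distrib)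
qed

lemma baecklund_reflectionI:
  assumes inv: "ratfun_involution \<phi>" and \<epsilon>: "\<epsilon> \<in> {1, -1}" "\<phi> T = const \<epsilon> * T" and k: "k \<le> 5"
    and A: "\<And>i. i \<le> 5 \<Longrightarrow> \<phi> (A i) = A i + const (reflection_coeff k i) * A k"
    and sol: "\<And>\<alpha> U x y z w q p.
      solves \<alpha> U x y z w q p \<Longrightarrow>
      \<forall>t\<in>U. \<forall>f\<in>{X, Y, Z, W, Q, P}.
        regular_at (\<phi> f) (point \<alpha> (x t) (y t) (z t) (w t) (q t) (p t) t) \<Longrightarrow>
      \<exists>x' y' z' w' q' p'.
        (\<forall>t\<in>U. list_all2 (\<lambda>f. has_value (\<phi> f) (point \<alpha> (x t) (y t) (z t) (w t) (q t) (p t) t))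
          [X, Y, Z, W, Q, P] [x' t, y' t, z' t, w' t, q' t, p' t]) \<and>
        solves (\<lambda>i. \<alpha> i + reflection_coeff k i * \<alpha> k) ((*) \<epsilon> ` U)
          (\<lambda>\<tau>. x' (\<epsilon> * \<tau>)) (\<lambda>\<tau>. y' (\<epsilon> * \<tau>)) (\<lambda>\<tau>. z' (\<epsilon> * \<tau>))
          (\<lambda>\<tau>. w' (\<epsilon> * \<tau>)) (\<lambda>\<tau>. q' (\<epsilon> * \<tau>)) (\<lambda>\<tau>. p' (\<epsilon> * \<tau>))"
  shows "baecklund \<phi>"
proof -
  define c :: "nat \<Rightarrow> nat \<Rightarrow> complex" where
    "c i j = (if j = i then 1 else 0) + (if j = k then reflection_coeff k i else 0)" for i j
  show ?thesis
  proof (rule baecklundI [OF inv \<epsilon>, where c = c], goal_cases)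
    case (1 i)
    show ?case
      unfolding c_def A [OF 1] by (rule sum_reflection [symmetric]) (simp_all add: const_add k 1)
  next
    case (2 \<alpha> U x y z w q p)
    have "\<alpha> i + reflection_coeff k i * \<alpha> k = (\<Sum>j\<le>5. c i j * \<alpha> j)" if "i \<le> 5" for i
      unfolding c_def by (rule sum_reflection [symmetric]) (simp_all add: k that)
    with sol [OF 2] show ?case
      by (elim exE conjE) (intro exI conjI, assumption, assumption, simp)
  qed
qed

lemma has_value_A5: "has_value A5 a (1 - 2 * a VA0 - 2 * a VA1 - 2 * a VA2 - 2 * a VA3 - a VA4)"
  unfolding A5_def by (intro has_value_intros)

lemma atMost_5_cases:
  assumes "i \<le> (5::nat)"
  obtains "i = 0" | "i = 1" | "i = 2" | "i = 3" | "i = 4" | "i = 5"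
  using assms by linarith

lemma baecklund_s0: "baecklund s0"
proof (rule baecklund_reflectionI [where k = 0 and \<epsilon> = "- 1"], goal_cases)
  case (5 i)
  then show ?case
    by (cases i rule: atMost_5_cases) (simp_all add: A_def reflection_coeff_def const_uminus)
next
  \<comment> \<open>The first step shows that the denominator does not vanish along the solution: the
        hypothesis says only that the images are regular there.\<close>
  case (6 \<alpha> U x y z w q p)
  note sol = 6(1) and reg = 6(2)
  let ?pt = "\<lambda>t. point \<alpha> (x t) (y t) (z t) (w t) (q t) (p t) t"
  have nz: "y t \<noteq> 0" if t: "t \<in> U" for t
  proof -
    note \<alpha>5 = solves_timeD(2) [OF sol t]
    have "regular_at (s0 X) (?pt t)" using reg t by simp
    moreover have "s0 X * (Y^2) = - X * Y^2 - 2 * A0 * Y - 1"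
      by (simp add: divide_simps; simp add: algebra_simps power2_eq_square)
    moreover have "has_value (Y^2) ((?pt t)(VA0 := ?pt t VA0 + s)) (y t^2)" for s
      by (rule has_value_eqI, (rule has_value_intros | simp; fail)+)
    moreover have "has_value (- X * Y^2 - 2 * A0 * Y - 1) ((?pt t)(VA0 := ?pt t VA0 + s))
        (- x t * (y t)^2 - 2 * (\<alpha> 0 + s) * y t - 1)" for s
      by (rule has_value_eqI, (rule has_value_intros has_value_A5 | simp add: \<alpha>5; fail)+)
    ultimately have "y t^2 \<noteq> 0"
      by (rule denominator_nonzero) auto
    then show ?thesis by simp
  qed
  have image_values: "\<forall>t\<in>U. list_all2 (\<lambda>f. has_value (s0 f) (?pt t)) [X, Y, Z, W, Q, P]
      [- x t - 2 * \<alpha> 0 / y t - 1 / y t^2, - y t, - z t, - w t, - q t, - p t]"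
  proof
    fix t assume t: "t \<in> U"
    note nz = nz [OF t] and \<alpha>5 = solves_timeD(2) [OF sol t]
    show "list_all2 (\<lambda>f. has_value (s0 f) (?pt t)) [X, Y, Z, W, Q, P]
        [- x t - 2 * \<alpha> 0 / y t - 1 / y t^2, - y t, - z t, - w t, - q t, - p t]"
      unfolding list_all2_Cons list_all2_Nil s0_images
      by (intro conjI refl; (rule has_value_eqI,
          (rule has_value_intros has_value_A5 | (use nz in \<open>simp add: \<alpha>5\<close>; fail))+))
  qed
  show ?case
    by (intro exI conjI, rule image_values, rule solves_s0 [OF sol nz])
qed (simp_all add: s0_involution const_uminus)

lemma baecklund_s1: "baecklund s1"
proof (rule baecklund_reflectionI [where k = 1 and \<epsilon> = "1"], goal_cases)
  case (5 i)
  then show ?case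
    by (cases i rule: atMost_5_cases) (simp_all add: A_def reflection_coeff_def const_uminus)
next
  case (6 \<alpha> U x y z w q p)
  note sol = 6(1) and reg = 6(2)
  let ?pt = "\<lambda>t. point \<alpha> (x t) (y t) (z t) (w t) (q t) (p t) t"
  have nz: "x t - z t \<noteq> 0" if t: "t \<in> U" for t
  proof -
    note \<alpha>5 = solves_timeD(2) [OF sol t]
    have "regular_at (s1 Y) (?pt t)" using reg t by simp
    moreover have "s1 Y * (X - Z) = Y * (X - Z) - A1"
      by (simp add: divide_simps; simp add: algebra_simps power2_eq_square)
    moreover have "has_value (X - Z) ((?pt t)(VA1 := ?pt t VA1 + s)) (x t - z t)" for s
      by (rule has_value_eqI, (rule has_value_intros | simp; fail)+)
    moreover have "has_value (Y * (X - Z) - A1) ((?pt t)(VA1 := ?pt t VA1 + s))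
        (y t * (x t - z t) - (\<alpha> 1 + s))" for s
      by (rule has_value_eqI, (rule has_value_intros has_value_A5 | simp add: \<alpha>5; fail)+)
    ultimately have "x t - z t \<noteq> 0"
      by (rule denominator_nonzero) auto
    then show ?thesis by simp
  qed
  have image_values: "\<forall>t\<in>U. list_all2 (\<lambda>f. has_value (s1 f) (?pt t)) [X, Y, Z, W, Q, P]
      [x t, y t - \<alpha> 1 / (x t - z t), z t, w t + \<alpha> 1 / (x t - z t), q t, p t]"
  proof
    fix t assume t: "t \<in> U"
    note nz = nz [OF t] and \<alpha>5 = solves_timeD(2) [OF sol t]
    show "list_all2 (\<lambda>f. has_value (s1 f) (?pt t)) [X, Y, Z, W, Q, P]
        [x t, y t - \<alpha> 1 / (x t - z t), z t, w t + \<alpha> 1 / (x t - z t), q t, p t]"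
      unfolding list_all2_Cons list_all2_Nil s1_images
      by (intro conjI refl; (rule has_value_eqI,
          (rule has_value_intros has_value_A5 | (use nz in \<open>simp add: \<alpha>5\<close>; fail))+))
  qed
  show ?case
    by (intro exI conjI, rule image_values, rule solves_s1 [OF sol nz])
qed (simp_all add: s1_involution const_uminus)

lemma baecklund_s2: "baecklund s2"
proof (rule baecklund_reflectionI [where k = 2 and \<epsilon> = "1"], goal_cases)
  case (5 i)
  then show ?case
    by (cases i rule: atMost_5_cases) (simp_all add: A_def reflection_coeff_def const_uminus)
next
  case (6 \<alpha> U x y z w q p)
  note sol = 6(1) and reg = 6(2)
  let ?pt = "\<lambda>t. point \<alpha> (x t) (y t) (z t) (w t) (q t) (p t) t"
  have nz: "w t \<noteq> 0" if t: "t \<in> U" for t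
  proof -
    note \<alpha>5 = solves_timeD(2) [OF sol t]
    have "regular_at (s2 Z) (?pt t)" using reg t by simp
    moreover have "s2 Z * (W) = Z * W + A2"
      by (simp add: divide_simps; simp add: algebra_simps power2_eq_square)
    moreover have "has_value (W) ((?pt t)(VA2 := ?pt t VA2 + s)) (w t)" for s
      by (rule has_value_eqI, (rule has_value_intros | simp; fail)+)
    moreover have "has_value (Z * W + A2) ((?pt t)(VA2 := ?pt t VA2 + s))
        (z t * w t + (\<alpha> 2 + s))" for s
      by (rule has_value_eqI, (rule has_value_intros has_value_A5 | simp add: \<alpha>5; fail)+)
    ultimately have "w t \<noteq> 0"
      by (rule denominator_nonzero) auto
    then show ?thesis by simp
  qed
  have image_values: "\<forall>t\<in>U. list_all2 (\<lambda>f. has_value (s2 f) (?pt t)) [X, Y, Z, W, Q, P]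
      [x t, y t, z t + \<alpha> 2 / w t, w t, q t, p t]"
  proof
    fix t assume t: "t \<in> U"
    note nz = nz [OF t] and \<alpha>5 = solves_timeD(2) [OF sol t]
    show "list_all2 (\<lambda>f. has_value (s2 f) (?pt t)) [X, Y, Z, W, Q, P]
        [x t, y t, z t + \<alpha> 2 / w t, w t, q t, p t]"
      unfolding list_all2_Cons list_all2_Nil s2_images
      by (intro conjI refl; (rule has_value_eqI,
          (rule has_value_intros has_value_A5 | (use nz in \<open>simp add: \<alpha>5\<close>; fail))+))
  qed
  show ?case
    by (intro exI conjI, rule image_values, rule solves_s2 [OF sol nz])
qed (simp_all add: s2_involution const_uminus)

lemma baecklund_s3: "baecklund s3"
proof (rule baecklund_reflectionI [where k = 3 and \<epsilon> = "1"], goal_cases)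
  case (5 i)
  then show ?case
    by (cases i rule: atMost_5_cases) (simp_all add: A_def reflection_coeff_def const_uminus)
next
  \<comment> \<open>At a point with \<open>z q = 1\<close> the numerator \<open>\<alpha>\<^sub>3 q\<close> changes with \<open>\<alpha>\<^sub>3\<close>, because \<open>q\<close> is nonzero
        there.\<close>
  case (6 \<alpha> U x y z w q p)
  note sol = 6(1) and reg = 6(2)
  let ?pt = "\<lambda>t. point \<alpha> (x t) (y t) (z t) (w t) (q t) (p t) t"
  have nz: "z t * q t - 1 \<noteq> 0" if t: "t \<in> U" for t
  proof -
    note \<alpha>5 = solves_timeD(2) [OF sol t]
    have "regular_at (s3 W) (?pt t)" using reg t by simp
    moreover have "s3 W * (Z * Q - 1) = W * (Z * Q - 1) - A3 * Q"
      by (simp add: divide_simps; simp add: algebra_simps power2_eq_square)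
    moreover have "has_value (Z * Q - 1) ((?pt t)(VA3 := ?pt t VA3 + s)) (z t * q t - 1)" for s
      by (rule has_value_eqI, (rule has_value_intros | simp; fail)+)
    moreover have "has_value (W * (Z * Q - 1) - A3 * Q) ((?pt t)(VA3 := ?pt t VA3 + s))
        (w t * (z t * q t - 1) - (\<alpha> 3 + s) * q t)" for s
      by (rule has_value_eqI, (rule has_value_intros has_value_A5 | simp add: \<alpha>5; fail)+)
    ultimately have "z t * q t - 1 \<noteq> 0"
      by (rule denominator_nonzero) auto
    then show ?thesis by simp
  qed
  have image_values: "\<forall>t\<in>U. list_all2 (\<lambda>f. has_value (s3 f) (?pt t)) [X, Y, Z, W, Q, P]
      [x t, y t, z t, w t - \<alpha> 3 * q t / (z t * q t - 1), q t, p t - \<alpha> 3 * z t / (z t * q t - 1)]"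
  proof
    fix t assume t: "t \<in> U"
    note nz = nz [OF t] and \<alpha>5 = solves_timeD(2) [OF sol t]
    show "list_all2 (\<lambda>f. has_value (s3 f) (?pt t)) [X, Y, Z, W, Q, P]
        [x t, y t, z t, w t - \<alpha> 3 * q t / (z t * q t - 1), q t, p t - \<alpha> 3 * z t / (z t * q t - 1)]"
      unfolding list_all2_Cons list_all2_Nil s3_images
      by (intro conjI refl; (rule has_value_eqI,
          (rule has_value_intros has_value_A5 | (use nz in \<open>simp add: \<alpha>5\<close>; fail))+))
  qed
  show ?case
    by (intro exI conjI, rule image_values, rule solves_s3 [OF sol nz])
qed (simp_all add: s3_involution const_uminus)

lemma baecklund_s4: "baecklund s4"
proof (rule baecklund_reflectionI [where k = 4 and \<epsilon> = "1"], goal_cases)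
  case (5 i)
  then show ?case
    by (cases i rule: atMost_5_cases) (simp_all add: A_def reflection_coeff_def const_uminus)
next
  case (6 \<alpha> U x y z w q p)
  note sol = 6(1) and reg = 6(2)
  let ?pt = "\<lambda>t. point \<alpha> (x t) (y t) (z t) (w t) (q t) (p t) t"
  have nz: "p t \<noteq> 0" if t: "t \<in> U" for t
  proof -
    note \<alpha>5 = solves_timeD(2) [OF sol t]
    have "regular_at (s4 Q) (?pt t)" using reg t by simp
    moreover have "s4 Q * (P) = Q * P + A4"
      by (simp add: divide_simps; simp add: algebra_simps power2_eq_square)
    moreover have "has_value (P) ((?pt t)(VA4 := ?pt t VA4 + s)) (p t)" for s
      by (rule has_value_eqI, (rule has_value_intros | simp; fail)+)
    moreover have "has_value (Q * P + A4) ((?pt t)(VA4 := ?pt t VA4 + s))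
        (q t * p t + (\<alpha> 4 + s))" for s
      by (rule has_value_eqI, (rule has_value_intros has_value_A5 | simp add: \<alpha>5; fail)+)
    ultimately have "p t \<noteq> 0"
      by (rule denominator_nonzero) auto
    then show ?thesis by simp
  qed
  have image_values: "\<forall>t\<in>U. list_all2 (\<lambda>f. has_value (s4 f) (?pt t)) [X, Y, Z, W, Q, P]
      [x t, y t, z t, w t, q t + \<alpha> 4 / p t, p t]"
  proof
    fix t assume t: "t \<in> U"
    note nz = nz [OF t] and \<alpha>5 = solves_timeD(2) [OF sol t]
    show "list_all2 (\<lambda>f. has_value (s4 f) (?pt t)) [X, Y, Z, W, Q, P]
        [x t, y t, z t, w t, q t + \<alpha> 4 / p t, p t]"
      unfolding list_all2_Cons list_all2_Nil s4_images
      by (intro conjI refl; (rule has_value_eqI,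
          (rule has_value_intros has_value_A5 | (use nz in \<open>simp add: \<alpha>5\<close>; fail))+))
  qed
  show ?case
    by (intro exI conjI, rule image_values, rule solves_s4 [OF sol nz])
qed (simp_all add: s4_involution const_uminus)

lemma baecklund_s5: "baecklund s5"
proof (rule baecklund_reflectionI [where k = 5 and \<epsilon> = "1"], goal_cases)
  case (5 i)
  then show ?case
    by (cases i rule: atMost_5_cases) (simp_all add: A_def reflection_coeff_def const_uminus)
next
  case (6 \<alpha> U x y z w q p)
  note sol = 6(1) and reg = 6(2)
  let ?pt = "\<lambda>t. point \<alpha> (x t) (y t) (z t) (w t) (q t) (p t) t"
  have nz: "p t - t \<noteq> 0" if t: "t \<in> U" for t
  proof -
    note \<alpha>5 = solves_timeD(2) [OF sol t]
    have "regular_at (s5 Q) (?pt t)" using reg t by simp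
    \<comment> \<open>\<open>A5\<close> is not an indeterminate, so it is moved through \<open>A4\<close>, with the opposite sign.\<close>
    moreover have "s5 Q * (P - T) = Q * (P - T) + A5"
      by (simp add: divide_simps; simp add: algebra_simps power2_eq_square)
    moreover have "has_value (P - T) ((?pt t)(VA4 := ?pt t VA4 + s)) (p t - t)" for s
      by (rule has_value_eqI, (rule has_value_intros | simp; fail)+)
    moreover have "has_value (Q * (P - T) + A5) ((?pt t)(VA4 := ?pt t VA4 + s))
        (q t * (p t - t) + (\<alpha> 5 - s))" for s
      by (rule has_value_eqI, (rule has_value_intros has_value_A5 | simp add: \<alpha>5; fail)+)
    ultimately have "p t - t \<noteq> 0"
      by (rule denominator_nonzero) auto
    then show ?thesis by simp
  qed
  have image_values: "\<forall>t\<in>U. list_all2 (\<lambda>f. has_value (s5 f) (?pt t)) [X, Y, Z, W, Q, P]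
      [x t, y t, z t, w t, q t + \<alpha> 5 / (p t - t), p t]"
  proof
    fix t assume t: "t \<in> U"
    note nz = nz [OF t] and \<alpha>5 = solves_timeD(2) [OF sol t]
    show "list_all2 (\<lambda>f. has_value (s5 f) (?pt t)) [X, Y, Z, W, Q, P]
        [x t, y t, z t, w t, q t + \<alpha> 5 / (p t - t), p t]"
      unfolding list_all2_Cons list_all2_Nil s5_images
      by (intro conjI refl; (rule has_value_eqI,
          (rule has_value_intros has_value_A5 | (use nz in \<open>simp add: \<alpha>5\<close>; fail))+))
  qed
  show ?case
    by (intro exI conjI, rule image_values, rule solves_s5 [OF sol nz])
qed (simp_all add: s5_involution const_uminus)

lemma sum_indicator:
  fixes e :: "complex \<Rightarrow> 'b::comm_ring_1" and k :: nat
  assumes "k \<le> 5" "e 0 = 0" "e 1 = 1"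
  shows "(\<Sum>j\<le>5. e (if j = k then 1 else 0) * a j) = a k"
proof -
  have "(\<Sum>j\<le>5. e (if j = k then 1 else 0) * a j) = (\<Sum>j\<le>5. if j = k then a j else 0)"
    by (rule sum.cong) (auto simp: assms)
  then show ?thesis using assms(1) by simp
qed

lemma baecklund_flip: "baecklund flip"
proof (rule baecklundI [where c = "\<lambda>i j. if j = (id(4 := 5, 5 := 4)) i then 1 else 0" and \<epsilon> = "- 1"],
    goal_cases)
  case (4 i)
  then show ?case
    by (subst sum_indicator) (cases i rule: atMost_5_cases; simp add: A_def)+
next
  case (5 \<alpha> U x y z w q p)
  let ?pt = "\<lambda>t. point \<alpha> (x t) (y t) (z t) (w t) (q t) (p t) t"
  have image_values: "\<forall>t\<in>U. list_all2 (\<lambda>f. has_value (flip f) (?pt t)) [X, Y, Z, W, Q, P]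
      [x t, y t, z t, w t, q t, p t - t]"
    unfolding list_all2_Cons list_all2_Nil flip_images
    by (intro ballI conjI refl; (rule has_value_eqI, (rule has_value_intros | simp; fail)+))
  have parameters: "\<forall>i\<le>5. \<alpha> ((id(4 := 5, 5 := 4)) i) =
      (\<Sum>j\<le>5. (if j = (id(4 := 5, 5 := 4)) i then 1 else 0) * \<alpha> j)"
    by (intro allI impI, subst sum_indicator [of _ "\<lambda>u. u"]) auto
  show ?case
    by (intro exI conjI, rule image_values, rule solves_flip [OF 5(1)], rule parameters)
qed (simp_all add: flip_involution const_uminus)

section \<open>The symmetry group\<close>

definition simple_reflection :: "nat \<Rightarrow> ratfun \<Rightarrow> ratfun" where
  "simple_reflection i = [s0, s1, s2, s3, s4, s5] ! i"

lemma involution_compose: "ratfun_involution \<phi> \<Longrightarrow> \<phi> \<circ> \<phi> = id"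
  by (simp add: fun_eq_iff ratfun_involution.hom_hom)

text \<open>
  For involutions, a relation \<open>(a \<circ> b) ^^ m = id\<close> and the braid relation of length \<open>m\<close> are
  equivalent; the latter only involves words of half the length.
\<close>

lemma coxeter_relation_2:
  fixes a b :: "'a \<Rightarrow> 'a"
  assumes "a \<circ> a = id" "b \<circ> b = id" and "a \<circ> b = b \<circ> a"
  shows "(a \<circ> b) ^^ 2 = id"
  using assms by (simp add: fun_eq_iff numeral_eq_Suc)

lemma coxeter_relation_3:
  fixes a b :: "'a \<Rightarrow> 'a"
  assumes "a \<circ> a = id" "b \<circ> b = id" and "a \<circ> b \<circ> a = b \<circ> a \<circ> b"
  shows "(a \<circ> b) ^^ 3 = id"
  using assms by (simp add: fun_eq_iff numeral_eq_Suc)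

lemma coxeter_relation_4:
  fixes a b :: "'a \<Rightarrow> 'a"
  assumes "a \<circ> a = id" "b \<circ> b = id" and "a \<circ> b \<circ> a \<circ> b = b \<circ> a \<circ> b \<circ> a"
  shows "(a \<circ> b) ^^ 4 = id"
  using assms by (simp add: fun_eq_iff numeral_eq_Suc)

lemma weyl_relations_simple_reflection: "weyl_relations_B5 simple_reflection"
proof -
  note involutions = s0_involution s1_involution s2_involution s3_involution s4_involution
    s5_involution
  note relations =
    braid_s0_s1 commute_s0_s2 commute_s0_s3 commute_s0_s4 commute_s0_s5 braid_s1_s2
    commute_s1_s3 commute_s1_s4 commute_s1_s5 braid_s2_s3 commute_s2_s4 commute_s2_s5
    braid_s3_s4 braid_s3_s5 commute_s4_s5
  note squares = involutions [THEN involution_compose]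
  have "(simple_reflection i \<circ> simple_reflection j) ^^ cox i j = id" if "i \<le> 5" "j \<le> 5" for i j
    by (rule atMost_5_cases [OF that(1)]; rule atMost_5_cases [OF that(2)];
        simp add: cox_def simple_reflection_def squares doubleton_eq_iff)
      (intro coxeter_relation_2 coxeter_relation_3 coxeter_relation_4 squares
        relations relations [symmetric])+
  then show ?thesis by (simp add: weyl_relations_B5_def)
qed

lemma diagram_automorphism_45: "diagram_automorphism (id(4 := 5, 5 := 4))"
proof -
  have "bij_betw (id(4 := 5, 5 := 4)) {..5} {..(5::nat)}"
    by (rule bij_betw_byWitness [where f' = "id(4 := 5, 5 := 4)"]) auto
  moreover have "cox ((id(4 := 5, 5 := 4)) i) ((id(4 := 5, 5 := 4)) j) = cox i j"
    if "i \<le> 5" "j \<le> 5" for i j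
    by (rule atMost_5_cases [OF that(1)]; rule atMost_5_cases [OF that(2)];
        simp add: cox_def doubleton_eq_iff)
  ultimately show ?thesis by (simp add: diagram_automorphism_def)
qed

lemma flip_conjugation:
  "i \<le> 5 \<Longrightarrow> flip \<circ> simple_reflection i \<circ> inv flip = simple_reflection ((id(4 := 5, 5 := 4)) i)"
proof -
  assume "i \<le> 5"
  have flip: "flip \<circ> flip = id" by (rule involution_compose [OF flip_involution])
  have "inv flip = flip" using flip flip by (rule inv_unique_comp)
  moreover have "flip \<circ> simple_reflection i = simple_reflection ((id(4 := 5, 5 := 4)) i) \<circ> flip"
    using \<open>i \<le> 5\<close> by (cases i rule: atMost_5_cases) (simp_all add: simple_reflection_def flip_reflection)
  ultimately show ?thesis using flip by (simp add: o_assoc [symmetric])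
qed

theorem theorem3p4:
  shows "\<exists>(s :: nat \<Rightarrow> ratfun \<Rightarrow> ratfun) (\<pi> :: ratfun \<Rightarrow> ratfun).
    map (s 0) generators =
      [- X - 2 * A0 / Y - 1 / Y^2, - Y, - Z, - W, - Q, - P, - T,
       - A0, A1 + 2 * A0, A2, A3, A4, A5] \<and>
    map (s 1) generators =
      [X, Y - A1 / (X - Z), Z, W + A1 / (X - Z), Q, P, T,
       A0 + A1, - A1, A2 + A1, A3, A4, A5] \<and>
    map (s 2) generators =
      [X, Y, Z + A2 / W, W, Q, P, T,
       A0, A1 + A2, - A2, A3 + A2, A4, A5] \<and>
    map (s 3) generators =
      [X, Y, Z, W - A3 * Q / (Z * Q - 1), Q, P - A3 * Z / (Z * Q - 1), T,
       A0, A1, A2 + A3, - A3, A4 + A3, A5 + A3] \<and>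
    map (s 4) generators =
      [X, Y, Z, W, Q + A4 / P, P, T,
       A0, A1, A2, A3 + A4, - A4, A5] \<and>
    map (s 5) generators =
      [X, Y, Z, W, Q + A5 / (P - T), P, T,
       A0, A1, A2, A3 + A5, A4, - A5] \<and>
    map \<pi> generators =
      [X, Y, Z, W, Q, P - T, - T,
       A0, A1, A2, A3, A5, A4] \<and>
    (\<forall>i\<le>5. baecklund (s i)) \<and> baecklund \<pi> \<and>
    weyl_relations_B5 s \<and>
    (let \<sigma> = id(4 := 5, 5 := 4) in
       diagram_automorphism \<sigma> \<and> (\<forall>i\<le>5. \<pi> \<circ> s i \<circ> inv \<pi> = s (\<sigma> i)))"
proof (intro exI [of _ simple_reflection] exI [of _ flip] conjI)
  show "\<forall>i\<le>5. baecklund (simple_reflection i)"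
  proof (intro allI impI)
    fix i :: nat assume "i \<le> 5"
    then show "baecklund (simple_reflection i)"
      by (cases i rule: atMost_5_cases) (simp_all add: simple_reflection_def baecklund_s0 baecklund_s1
          baecklund_s2 baecklund_s3 baecklund_s4 baecklund_s5)
  qed
  show "let \<sigma> = id(4 := 5, 5 := 4) in
      diagram_automorphism \<sigma> \<and> (\<forall>i\<le>5. flip \<circ> simple_reflection i \<circ> inv flip = simple_reflection (\<sigma> i))"
    unfolding Let_def using diagram_automorphism_45 flip_conjugation by blast
qed (simp_all add: generators_def simple_reflection_def baecklund_flip weyl_relations_simple_reflection)

end
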